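(* Let $\mathscr M$ and $\mathscr N$ be von Neumann algebras such that $\mathscr M$ has no direct summand of type $\mathrm{I}_1$, and let $\varphi\colon\mathscr M\to\mathscr N$ be an ortho-additive ortho-isomorphism. Then there exists a map $\Phi\colon\mathscr M\to\mathscr N$ such that $$\varphi(A)=\Phi(A)\varphi(I)\quad\text{for all } A\in\mathscr M,$$ and $\Phi$ is the direct sum of a *-isomorphism and a conjugate *-isomorphism.
   Context: A von Neumann algebra is a self-adjoint unital subalgebra of $\mathscr{B}(\mathscr H)$, closed in the weak-operator topology, where $\mathscr H$ is a complex Hilbert space (not necessarily separable); $I$ is its identity. "$\mathscr M$ has no direct summand of type $\mathrm{I}_1$" means there is no nonzero central projection $Z\in\mathscr M$ such that $\mathscr MZ$ is abelian. Operators $A,B$ in a von Neumann algebra are orthogonal, written $A\perp B$, if $A^*B=0$. A map $\varphi\colon\mathscr M\to\mathscr N$ (not assumed linear) is ortho-additive if $\varphi(A+B)=\varphi(A)+\varphi(B)$ for all $A,B\in\mathscr M$ with $A\perp B$. It is an ortho-isomorphism if it is bijective and, for all $A,B\in\mathscr M$, $A\perp B$ if and only if $\varphi(A)\perp\varphi(B)$. A conjugate *-isomorphism is a bijective conjugate-linear multiplicative *-preserving map. "$\Phi\colon\mathscr M\to\mathscr N$ is the direct sum of a *-isomorphism and a conjugate *-isomorphism" means that there are decompositions $\mathscr M=\mathscr M_1\oplus\mathscr M_2$ and $\mathscr N=\mathscr N_1\oplus\mathscr N_2$ given by central projections (a summand may be zero), and $\Phi=\Phi_1\oplus\Phi_2$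 with $\Phi_1\colon\mathscr M_1\to\mathscr N_1$ a *-isomorphism and $\Phi_2\colon\mathscr M_2\to\mathscr N_2$ a conjugate *-isomorphism. *)

theory Defs
  imports "HOL-Analysis.Analysis"
begin

(* A complex Hilbert space of arbitrary dimension. The norm axioms come from the superclass
   banach, so norm_cinner also makes the inner product positive definite. *)
class chilbert_space = banach +
  fixes scaleC :: "complex \<Rightarrow> 'a \<Rightarrow> 'a"  (infixr "*\<^sub>C" 75)
    and cinner :: "'a \<Rightarrow> 'a \<Rightarrow> complex"
  assumes scaleC_add_right: "c *\<^sub>C (x + y) = c *\<^sub>C x + c *\<^sub>C y"
    and scaleC_add_left: "(c + d) *\<^sub>C x = c *\<^sub>C x + d *\<^sub>C x"
    and scaleC_scaleC: "c *\<^sub>C d *\<^sub>C x = (c * d) *\<^sub>C x"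
    and scaleR_scaleC: "r *\<^sub>R x = complex_of_real r *\<^sub>C x"
    and cinner_commute: "cinner x y = cnj (cinner y x)"
    and cinner_add_left: "cinner (x + y) z = cinner x z + cinner y z"
    and cinner_scaleC_left: "cinner (c *\<^sub>C x) y = c * cinner x y"
    and norm_cinner: "cinner x x = complex_of_real ((norm x)\<^sup>2)"

instantiation complex :: chilbert_space
begin
definition scaleC_complex :: "complex \<Rightarrow> complex \<Rightarrow> complex"
  where "scaleC_complex c z = c * z"
definition cinner_complex :: "complex \<Rightarrow> complex \<Rightarrow> complex"
  where "cinner_complex z w = z * cnj w"
instance
  by standard
    (auto simp: scaleC_complex_def cinner_complex_def algebra_simps scaleR_conv_of_real
      complex_norm_square simp del: of_real_power)
end

lemma norm_scaleC: "norm (c *\<^sub>C x) = cmod c * norm (x :: 'h::chilbert_space)"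
proof -
  have "cinner (c *\<^sub>C x) (c *\<^sub>C x) = c * cnj (c * cinner x x)"
    by (metis cinner_commute cinner_scaleC_left)
  also have "\<dots> = (c * cnj c) * cinner x x"
    by (simp add: norm_cinner)
  finally have "complex_of_real ((norm (c *\<^sub>C x))\<^sup>2) = complex_of_real ((cmod c * norm x)\<^sup>2)"
    by (simp add: norm_cinner complex_norm_square[symmetric] power_mult_distrib)
  then have "(norm (c *\<^sub>C x))\<^sup>2 = (cmod c * norm x)\<^sup>2"
    by (simp only: of_real_eq_iff)
  then show ?thesis
    by (simp add: power2_eq_iff_nonneg)
qed

lemma bounded_linear_scaleC: "bounded_linear (\<lambda>x :: 'h::chilbert_space. c *\<^sub>C x)"
  by (rule bounded_linear_intro[where K = "cmod c"])
    (simp_all add: scaleC_add_right scaleR_scaleC scaleC_scaleC norm_scaleC mult.commute)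

(* The elements of the library type of bounded operators are only real-linear;
   B(H) consists of the complex-linear ones. *)
definition bounded_ops :: "('h::chilbert_space \<Rightarrow>\<^sub>L 'h) set"
  where "bounded_ops = {A. \<forall>c x. blinfun_apply A (c *\<^sub>C x) = c *\<^sub>C blinfun_apply A x}"

lift_definition op_scaleC :: "complex \<Rightarrow> ('h::chilbert_space \<Rightarrow>\<^sub>L 'h) \<Rightarrow> ('h \<Rightarrow>\<^sub>L 'h)"
  is "\<lambda>c A x. c *\<^sub>C A x"
  by (rule bounded_linear_compose[OF bounded_linear_scaleC])

(* For A in B(H) the operator described exists and is unique, by the Riesz representation
   theorem, and it belongs to B(H). *)
definition adj :: "('h::chilbert_space \<Rightarrow>\<^sub>L 'h) \<Rightarrow> ('h \<Rightarrow>\<^sub>L 'h)"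
  where "adj A =
    (THE B. \<forall>x y. cinner (blinfun_apply A x) y = cinner x (blinfun_apply B y))"

(* The coarsest topology on B(H) that makes every map T |-> <T x, y> continuous: the function
   space carries the topology of pointwise convergence. *)
definition weak_operator_topology :: "('h::chilbert_space \<Rightarrow>\<^sub>L 'h) topology"
  where "weak_operator_topology =
    pullback_topology bounded_ops (\<lambda>T (x, y). cinner (blinfun_apply T x) y) euclidean"

definition von_neumann_algebra :: "('h::chilbert_space \<Rightarrow>\<^sub>L 'h) set \<Rightarrow> bool"
  where "von_neumann_algebra M \<longleftrightarrow>
    M \<subseteq> bounded_ops \<and>
    id_blinfun \<in> M \<and>
    (\<forall>A\<in>M. \<forall>B\<in>M. A + B \<in> M) \<and>
    (\<forall>c. \<forall>A\<in>M. op_scaleC c A \<in> M) \<and>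
    (\<forall>A\<in>M. \<forall>B\<in>M. A o\<^sub>L B \<in> M) \<and>
    (\<forall>A\<in>M. adj A \<in> M) \<and>
    closedin weak_operator_topology M"

definition central_projection ::
    "('h::chilbert_space \<Rightarrow>\<^sub>L 'h) set \<Rightarrow> ('h \<Rightarrow>\<^sub>L 'h) \<Rightarrow> bool"
  where "central_projection M Z \<longleftrightarrow>
    Z \<in> M \<and> Z o\<^sub>L Z = Z \<and> adj Z = Z \<and> (\<forall>A\<in>M. A o\<^sub>L Z = Z o\<^sub>L A)"

(* The summand MZ, realised on the whole space; its unit is Z. *)
definition summand ::
    "('h::chilbert_space \<Rightarrow>\<^sub>L 'h) set \<Rightarrow> ('h \<Rightarrow>\<^sub>L 'h) \<Rightarrow> ('h \<Rightarrow>\<^sub>L 'h) set"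
  where "summand M Z = {A o\<^sub>L Z | A. A \<in> M}"

definition abelian :: "('h::chilbert_space \<Rightarrow>\<^sub>L 'h) set \<Rightarrow> bool"
  where "abelian S \<longleftrightarrow> (\<forall>A\<in>S. \<forall>B\<in>S. A o\<^sub>L B = B o\<^sub>L A)"

definition no_type_I1_summand :: "('h::chilbert_space \<Rightarrow>\<^sub>L 'h) set \<Rightarrow> bool"
  where "no_type_I1_summand M \<longleftrightarrow>
    \<not> (\<exists>Z. central_projection M Z \<and> Z \<noteq> 0 \<and> abelian (summand M Z))"

definition op_orthogonal ::
    "('h::chilbert_space \<Rightarrow>\<^sub>L 'h) \<Rightarrow> ('h \<Rightarrow>\<^sub>L 'h) \<Rightarrow> bool"
  where "op_orthogonal A B \<longleftrightarrow> adj A o\<^sub>L B = 0"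

definition ortho_additive ::
    "('h::chilbert_space \<Rightarrow>\<^sub>L 'h) set \<Rightarrow>
      (('h \<Rightarrow>\<^sub>L 'h) \<Rightarrow> ('k::chilbert_space \<Rightarrow>\<^sub>L 'k)) \<Rightarrow> bool"
  where "ortho_additive M \<phi> \<longleftrightarrow>
    (\<forall>A\<in>M. \<forall>B\<in>M. op_orthogonal A B \<longrightarrow> \<phi> (A + B) = \<phi> A + \<phi> B)"

definition ortho_isomorphism ::
    "('h::chilbert_space \<Rightarrow>\<^sub>L 'h) set \<Rightarrow> ('k::chilbert_space \<Rightarrow>\<^sub>L 'k) set \<Rightarrow>
      (('h \<Rightarrow>\<^sub>L 'h) \<Rightarrow> ('k \<Rightarrow>\<^sub>L 'k)) \<Rightarrow> bool"
  where "ortho_isomorphism M N \<phi> \<longleftrightarrow>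
    bij_betw \<phi> M N \<and>
    (\<forall>A\<in>M. \<forall>B\<in>M. op_orthogonal A B \<longleftrightarrow> op_orthogonal (\<phi> A) (\<phi> B))"

definition star_isomorphism ::
    "('h::chilbert_space \<Rightarrow>\<^sub>L 'h) set \<Rightarrow> ('k::chilbert_space \<Rightarrow>\<^sub>L 'k) set \<Rightarrow>
      (('h \<Rightarrow>\<^sub>L 'h) \<Rightarrow> ('k \<Rightarrow>\<^sub>L 'k)) \<Rightarrow> bool"
  where "star_isomorphism S T \<Psi> \<longleftrightarrow>
    bij_betw \<Psi> S T \<and>
    (\<forall>A\<in>S. \<forall>B\<in>S. \<Psi> (A + B) = \<Psi> A + \<Psi> B) \<and>
    (\<forall>c. \<forall>A\<in>S. \<Psi> (op_scaleC c A) = op_scaleC c (\<Psi> A)) \<and>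
    (\<forall>A\<in>S. \<forall>B\<in>S. \<Psi> (A o\<^sub>L B) = \<Psi> A o\<^sub>L \<Psi> B) \<and>
    (\<forall>A\<in>S. \<Psi> (adj A) = adj (\<Psi> A))"

definition conj_star_isomorphism ::
    "('h::chilbert_space \<Rightarrow>\<^sub>L 'h) set \<Rightarrow> ('k::chilbert_space \<Rightarrow>\<^sub>L 'k) set \<Rightarrow>
      (('h \<Rightarrow>\<^sub>L 'h) \<Rightarrow> ('k \<Rightarrow>\<^sub>L 'k)) \<Rightarrow> bool"
  where "conj_star_isomorphism S T \<Psi> \<longleftrightarrow>
    bij_betw \<Psi> S T \<and>
    (\<forall>A\<in>S. \<forall>B\<in>S. \<Psi> (A + B) = \<Psi> A + \<Psi> B) \<and>
    (\<forall>c. \<forall>A\<in>S. \<Psi> (op_scaleC c A) = op_scaleC (cnj c) (\<Psi> A)) \<and>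
    (\<forall>A\<in>S. \<forall>B\<in>S. \<Psi> (A o\<^sub>L B) = \<Psi> A o\<^sub>L \<Psi> B) \<and>
    (\<forall>A\<in>S. \<Psi> (adj A) = adj (\<Psi> A))"

(* Either of P, id - P (and of Q, id - Q) may be zero. *)
definition direct_sum_star_conj_star ::
    "('h::chilbert_space \<Rightarrow>\<^sub>L 'h) set \<Rightarrow> ('k::chilbert_space \<Rightarrow>\<^sub>L 'k) set \<Rightarrow>
      (('h \<Rightarrow>\<^sub>L 'h) \<Rightarrow> ('k \<Rightarrow>\<^sub>L 'k)) \<Rightarrow> bool"
  where "direct_sum_star_conj_star M N \<Phi> \<longleftrightarrow>
    (\<exists>P Q \<Phi>\<^sub>1 \<Phi>\<^sub>2.
      central_projection M P \<and> central_projection N Q \<and>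
      star_isomorphism (summand M P) (summand N Q) \<Phi>\<^sub>1 \<and>
      conj_star_isomorphism (summand M (id_blinfun - P)) (summand N (id_blinfun - Q)) \<Phi>\<^sub>2 \<and>
      (\<forall>A\<in>M. \<Phi> A = \<Phi>\<^sub>1 (A o\<^sub>L P) + \<Phi>\<^sub>2 (A o\<^sub>L (id_blinfun - P))))"

end

(* Writing pi(p) for the range projection of phi(p), ortho-additivity gives phi(pA) = pi(p) phi(A)
   for every projection p. The corners x = e F (1 - e), where e and F are projections of M, are all
   the small elements of e M (1 - e), so left multiplication by such an x is turned by phi into left
   multiplication by an element of N. Computing phi(e F (eA + (1 - e)B)) in two ways shows that
   every additivity defect of phi is annihilated by all corners, hence vanishes because M has no
   summand of type I_1. The corners generate an ideal, on which the multiplier map rho is defined, and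
   rho extends from the ideal to M, again because its annihilator is zero. The resulting *-preserving
   ring isomorphism rho is automatically real-linear, and rho(i) splits it into a linear and a
   conjugate-linear part. *)
theory Submission
  imports Defs
begin

text \<open>The obstacle is that \<phi> is known to be additive only on orthogonal pairs and is not
  assumed homogeneous, so linear or spectral arguments cannot be applied to it directly.
  Orthogonality depends only on ranges, which makes projections the first elements whose left
  multiplication can be transported; products of projections follow. The block e F e must also be
  invertible on e: left multiplication by e F then turns suitable orthogonal pairs into an arbitrary
  A = e A and x B. Smallness of x serves this, and also the square root that builds F.

  If C is annihilated by all corners, its range projection p is central and every projection
  commutes with M on p. Passing from projections to all operators would usually invoke the spectral
  theorem. Here the factorisation h = (2e - 1)|h| and a repeated halving of commutators replace it,
  and square roots and range projections come from explicit iterations.\<close>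

notation blinfun_compose (infixl "\<odot>" 70)

section \<open>Hilbert spaces and adjoints\<close>

lemma cinner_add_right: "cinner x (y + z) = cinner x y + cinner x (z :: 'h::chilbert_space)"
  by (metis cinner_commute cinner_add_left complex_cnj_add)

lemma cinner_scaleC_right: "cinner x (c *\<^sub>C y) = cnj c * cinner x (y :: 'h::chilbert_space)"
  by (metis cinner_commute cinner_scaleC_left complex_cnj_mult)

lemma cinner_scaleR_left: "cinner (r *\<^sub>R x) y = of_real r * cinner x (y :: 'h::chilbert_space)"
  by (simp add: scaleR_scaleC cinner_scaleC_left)

lemma cinner_scaleR_right: "cinner x (r *\<^sub>R y) = of_real r * cinner x (y :: 'h::chilbert_space)"
  by (simp add: scaleR_scaleC cinner_scaleC_right)

lemma cinner_zero_left: "cinner 0 (y :: 'h::chilbert_space) = 0"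
  using cinner_scaleR_left[of 0 0 y] by simp

lemma cinner_zero_right: "cinner (y :: 'h::chilbert_space) 0 = 0"
  using cinner_scaleR_right[of y 0 0] by simp

lemma cinner_minus_left: "cinner (- x) y = - cinner x (y :: 'h::chilbert_space)"
  using cinner_scaleR_left[of "-1" x y] by simp

lemma cinner_minus_right: "cinner x (- y) = - cinner x (y :: 'h::chilbert_space)"
  using cinner_scaleR_right[of x "-1" y] by simp

lemma cinner_diff_left: "cinner (x - y) z = cinner x z - cinner y (z :: 'h::chilbert_space)"
  using cinner_add_left[of x "- y" z] by (simp add: cinner_minus_left)

lemma cinner_diff_right: "cinner x (y - z) = cinner x y - cinner x (z :: 'h::chilbert_space)"
  using cinner_add_right[of x y "- z"] by (simp add: cinner_minus_right)

lemmas cinner_simps = cinner_add_left cinner_add_right cinner_scaleC_left cinner_scaleC_right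
  cinner_scaleR_left cinner_scaleR_right cinner_zero_left cinner_zero_right
  cinner_minus_left cinner_minus_right cinner_diff_left cinner_diff_right

lemma Re_cinner_commute: "Re (cinner x y) = Re (cinner y (x :: 'h::chilbert_space))"
  by (subst cinner_commute) simp

lemma norm_add_cinner:
  "(norm (x + y))\<^sup>2 = (norm x)\<^sup>2 + (norm (y :: 'h::chilbert_space))\<^sup>2 + 2 * Re (cinner x y)"
proof -
  have "complex_of_real ((norm (x + y))\<^sup>2)
      = complex_of_real ((norm x)\<^sup>2) + complex_of_real ((norm y)\<^sup>2) + (cinner x y + cinner y x)"
    by (simp only: norm_cinner[symmetric] cinner_simps) simp
  then have "Re (complex_of_real ((norm (x + y))\<^sup>2))
      = Re (complex_of_real ((norm x)\<^sup>2) + complex_of_real ((norm y)\<^sup>2) + (cinner x y + cinner y x))"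
    by (rule arg_cong)
  then show ?thesis
    using Re_cinner_commute[of x y] by (simp del: of_real_power)
qed

lemma norm_diff_cinner:
  "(norm (x - y))\<^sup>2 = (norm x)\<^sup>2 + (norm (y :: 'h::chilbert_space))\<^sup>2 - 2 * Re (cinner x y)"
  using norm_add_cinner[of x "- y"] by (simp add: cinner_simps)

lemma Re_cinner_self: "Re (cinner x x) = (norm (x :: 'h::chilbert_space))\<^sup>2"
  by (simp add: norm_cinner del: of_real_power)

text \<open>The first-order condition for a minimum at t = 0; the test point
  \<open>- b / (2 * a)\<close> is the vertex of the parabola.\<close>

lemma nonneg_quadratic_imp_linear_zero:
  fixes a b :: real
  assumes "\<And>t. 0 \<le> t\<^sup>2 * a + t * b" and "0 \<le> a"
  shows "b = 0"
proof (cases "a = 0")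
  case True
  then show ?thesis using assms(1)[of 1] assms(1)[of "-1"] by simp
next
  case False
  then have "a > 0" using assms(2) by simp
  have "0 \<le> (- b / (2 * a))\<^sup>2 * a + (- b / (2 * a)) * b" by (rule assms)
  also have "\<dots> = - (b\<^sup>2 / (4 * a))"
    using \<open>a > 0\<close> by (simp add: field_simps power2_eq_square)
  finally have "b\<^sup>2 / (4 * a) \<le> 0" by simp
  then show ?thesis using \<open>a > 0\<close> by (simp add: divide_le_0_iff)
qed

lemma Re_cinner_le_norm: "\<bar>Re (cinner x y)\<bar> \<le> norm x * norm (y :: 'h::chilbert_space)"
proof -
  have *: "Re (cinner x y) \<le> norm x * norm y" for x y :: 'h
  proof (cases "x = 0 \<or> y = 0")
    case True
    then show ?thesis by (auto simp: cinner_simps)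
  next
    case False
    then have p: "norm x * norm y > 0" by simp
    have "0 \<le> (norm (norm y *\<^sub>R x - norm x *\<^sub>R y))\<^sup>2" by simp
    also have "\<dots> = 2 * (norm x * norm y) * (norm x * norm y - Re (cinner x y))"
      unfolding norm_diff_cinner
      by (simp add: cinner_simps power2_eq_square algebra_simps)
    finally show ?thesis using p by (simp add: zero_le_mult_iff)
  qed
  show ?thesis using *[of x y] *[of "- x" y] by (simp add: cinner_simps abs_le_iff)
qed

lemma norm_cinner_le: "cmod (cinner x y) \<le> norm x * norm (y :: 'h::chilbert_space)"
proof -
  define c where "c = cnj (cinner x y)"
  have "cmod c * cmod c = Re (c * cinner x y)"
    by (simp add: c_def complex_mult_cnj cmod_power2 power2_eq_square[symmetric] mult.commute)
  also have "\<dots> = Re (cinner (c *\<^sub>C x) y)" by (simp add: cinner_simps)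
  also have "\<dots> \<le> cmod c * (norm x * norm y)"
    using Re_cinner_le_norm[of "c *\<^sub>C x" y] by (simp add: norm_scaleC)
  finally have "cmod c \<le> norm x * norm y" by (cases "c = 0") auto
  then show ?thesis by (simp add: c_def)
qed

lemma bounded_linear_cinner_left: "bounded_linear (\<lambda>x. cinner x (y :: 'h::chilbert_space))"
  by (rule bounded_linear_intro[where K = "norm y"])
    (simp_all add: cinner_simps norm_cinner_le scaleR_conv_of_real)

lemma bounded_linear_cinner_right: "bounded_linear (\<lambda>y. cinner x (y :: 'h::chilbert_space))"
  by (rule bounded_linear_intro[where K = "norm x"])
    (simp_all add: cinner_simps scaleR_conv_of_real, metis norm_cinner_le mult.commute)

lemmas tendsto_cinner_left = bounded_linear.tendsto[OF bounded_linear_cinner_left]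
lemmas tendsto_cinner_right = bounded_linear.tendsto[OF bounded_linear_cinner_right]
lemmas tendsto_scaleC = bounded_linear.tendsto[OF bounded_linear_scaleC]

lemma cinner_eqI:
  assumes "\<And>x. cinner x y = cinner x (z :: 'h::chilbert_space)"
  shows "y = z"
proof -
  have "cinner (y - z) (y - z) = 0"
    using assms[of "y - z"] by (simp only: cinner_diff_right) simp
  then show ?thesis by (simp add: norm_cinner)
qed

text \<open>Replacing x by ix exchanges real and imaginary parts, so a variational argument over the
  reals determines the complex functional.\<close>

lemma Re_cinner_imp_cinner:
  assumes "\<And>x. Re (cinner x (y :: 'h::chilbert_space)) = Re (f x)"
    and "\<And>c x. f (c *\<^sub>C x) = c * f x"
  shows "cinner x y = f x"
proof (rule complex_eqI)
  show "Re (cinner x y) = Re (f x)" by (rule assms(1))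
  show "Im (cinner x y) = Im (f x)"
    using assms(1)[of "\<i> *\<^sub>C x"] by (simp add: assms(2) cinner_simps)
qed

text \<open>The representing vector minimises \<open>\<parallel>x\<parallel>\<^sup>2 - 2 Re (f x)\<close>, and a minimising
  sequence is Cauchy by the parallelogram law.\<close>

lemma riesz_representation:
  fixes f :: "'h::chilbert_space \<Rightarrow> complex"
  assumes lin: "bounded_linear f" and sc: "\<And>c x. f (c *\<^sub>C x) = c * f x"
  shows "\<exists>z. \<forall>x. f x = cinner x z"
proof -
  interpret f: bounded_linear f by (rule lin)
  define g where "g x = (norm x)\<^sup>2 - 2 * Re (f x)" for x
  obtain K where K: "\<And>x. norm (f x) \<le> norm x * K" using f.bounded by blast
  have low: "- K\<^sup>2 \<le> g x" for x
  proof -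
    have "Re (f x) \<le> norm x * K" using K[of x] complex_Re_le_cmod[of "f x"] by linarith
    moreover have "0 \<le> (norm x - K)\<^sup>2" by simp
    ultimately show ?thesis unfolding g_def power2_eq_square by (simp add: algebra_simps)
  qed
  define m where "m = Inf (range g)"
  have bdd: "bdd_below (range g)" using low by (auto intro!: bdd_belowI2)
  have m: "m \<le> g x" for x unfolding m_def by (rule cInf_lower) (auto intro: bdd)
  have "\<exists>x. g x < m + 1 / Suc n" for n
  proof -
    have "Inf (range g) < m + 1 / Suc n" by (simp add: m_def)
    then show ?thesis by (subst (asm) cInf_less_iff) (auto intro: bdd)
  qed
  then obtain X where X: "\<And>n. g (X n) < m + 1 / Suc n" by metis
  have par: "(norm (x - y))\<^sup>2 = 2 * g x + 2 * g y - 4 * g ((1/2) *\<^sub>R (x + y))" for x y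
  proof -
    have "(norm ((1/2) *\<^sub>R (x + y)))\<^sup>2 = (norm (x + y))\<^sup>2 / 4"
      by (simp add: power_divide)
    moreover have "Re (f ((1/2) *\<^sub>R (x + y))) = (Re (f x) + Re (f y)) / 2"
      by (simp only: f.add f.scaleR) simp
    ultimately show ?thesis
      unfolding g_def norm_diff_cinner norm_add_cinner by (simp add: field_simps)
  qed
  have near: "(norm (x - y))\<^sup>2 \<le> 4 * d" if "g x \<le> m + d" "g y \<le> m + d" for x y d
    using par[of x y] m[of "(1/2) *\<^sub>R (x + y)"] that by linarith
  have "Cauchy X"
  proof (rule metric_CauchyI)
    fix e :: real assume e: "e > 0"
    then obtain N :: nat where N: "1 / Suc N < e\<^sup>2 / 4"
      using nat_approx_posE[of "e\<^sup>2 / 4"] by auto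
    have ge: "g (X n) \<le> m + 1 / Suc N" if "n \<ge> N" for n
    proof -
      have "1 / real (Suc n) \<le> 1 / Suc N" using that by (simp add: field_simps)
      then show ?thesis using X[of n] by linarith
    qed
    show "\<exists>M. \<forall>n\<ge>M. \<forall>k\<ge>M. dist (X n) (X k) < e"
    proof (intro exI allI impI)
      fix n k assume "N \<le> n" "N \<le> k"
      then have "(norm (X n - X k))\<^sup>2 \<le> 4 * (1 / Suc N)" by (intro near ge)
      also have "\<dots> < e\<^sup>2" using N by simp
      finally show "dist (X n) (X k) < e"
        using e by (auto simp: dist_norm intro: power2_less_imp_less)
    qed
  qed
  then obtain z where z: "X \<longlonglongrightarrow> z" using convergentD Cauchy_convergent_iff by blast
  have "(\<lambda>n. g (X n)) \<longlonglongrightarrow> g z"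
    unfolding g_def by (intro tendsto_intros z f.tendsto)
  moreover have "(\<lambda>n. m + 1 / Suc n) \<longlonglongrightarrow> m + 0"
    by (intro tendsto_add tendsto_const LIMSEQ_Suc[OF lim_1_over_n])
  ultimately have "g z \<le> m + 0"
    by (rule LIMSEQ_le) (use X less_imp_le in blast)
  then have min: "g z \<le> g x" for x using m[of x] by simp
  have "Re (cinner x z) = Re (f x)" for x
  proof -
    have "0 \<le> t\<^sup>2 * (norm x)\<^sup>2 + t * (2 * Re (cinner x z) - 2 * Re (f x))" for t
    proof -
      have "g (z + t *\<^sub>R x) = g z + (t\<^sup>2 * (norm x)\<^sup>2 + t * (2 * Re (cinner x z) - 2 * Re (f x)))"
        unfolding g_def norm_add_cinner f.add f.scaleR cinner_scaleR_right
        by (simp add: Re_cinner_commute[of z x] power_mult_distrib ring_distribs)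
      then show ?thesis using min[of "z + t *\<^sub>R x"] by linarith
    qed
    from nonneg_quadratic_imp_linear_zero[OF this] show ?thesis by simp
  qed
  then have "cinner x z = f x" for x by (rule Re_cinner_imp_cinner) (rule sc)
  then show ?thesis by (intro exI[of _ z]) simp
qed

section \<open>Adjoints of bounded complex-linear operators\<close>

lemma bounded_opsD: "A \<in> bounded_ops \<Longrightarrow> blinfun_apply A (c *\<^sub>C x) = c *\<^sub>C blinfun_apply A x"
  by (simp add: bounded_ops_def)

lemma adj_eqI:
  assumes "\<And>x y. cinner (blinfun_apply A x) y = cinner x (blinfun_apply B y)"
  shows "adj A = B"
  unfolding adj_def
proof (rule the_equality)
  show "\<forall>x y. cinner (blinfun_apply A x) y = cinner x (blinfun_apply B y)" using assms by blast
next
  fix C assume "\<forall>x y. cinner (blinfun_apply A x) y = cinner x (blinfun_apply C y)"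
  then have "cinner x (blinfun_apply C y) = cinner x (blinfun_apply B y)" for x y
    using assms by metis
  then show "C = B" by - (rule blinfun_eqI, rule cinner_eqI, simp)
qed

lemma cinner_adj_right:
  assumes A: "A \<in> bounded_ops"
  shows "cinner (blinfun_apply A x) y = cinner x (blinfun_apply (adj A) y)"
proof -
  have "\<exists>z. \<forall>x. cinner (blinfun_apply A x) y = cinner x z" for y
    by (rule riesz_representation)
      (auto intro: bounded_linear_compose[OF bounded_linear_cinner_left blinfun.bounded_linear_right]
        simp: bounded_opsD[OF A] cinner_simps)
  then obtain b where b: "\<And>x y. cinner (blinfun_apply A x) y = cinner x (b y)" by metis
  have bl: "bounded_linear b"
  proof (rule bounded_linear_intro[where K = "norm A"])
    show "b (x + y) = b x + b y" for x y
      by (rule cinner_eqI) (simp add: cinner_simps flip: b)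
    show "b (r *\<^sub>R x) = r *\<^sub>R b x" for r x
      by (rule cinner_eqI) (simp add: cinner_simps flip: b)
    \<comment> \<open>Testing the defining identity at x = b y bounds the square of
      \<open>norm (b y)\<close>; one factor is then cancelled.\<close>
    show "norm (b y) \<le> norm y * norm A" for y
    proof -
      have "norm (b y) * norm (b y) = Re (cinner (b y) (b y))"
        by (simp add: Re_cinner_self power2_eq_square)
      also have "\<dots> = Re (cinner (blinfun_apply A (b y)) y)" by (simp add: b)
      also have "\<dots> \<le> norm (blinfun_apply A (b y)) * norm y"
        using Re_cinner_le_norm[of "blinfun_apply A (b y)" y] by linarith
      also have "\<dots> \<le> (norm A * norm (b y)) * norm y"
        by (intro mult_right_mono norm_blinfun) simp
      finally have "norm (b y) * norm (b y) \<le> norm (b y) * (norm y * norm A)"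
        by (simp add: mult_ac)
      then show ?thesis by (cases "b y = 0") auto
    qed
  qed
  then have "adj A = Blinfun b"
    by (intro adj_eqI) (simp add: b bounded_linear_Blinfun_apply)
  then show ?thesis by (simp add: b bl bounded_linear_Blinfun_apply)
qed

lemma cinner_adj_left:
  "A \<in> bounded_ops \<Longrightarrow> cinner (blinfun_apply (adj A) x) y = cinner x (blinfun_apply A y)"
  by (metis cinner_adj_right cinner_commute)

lemma adj_bounded_ops:
  assumes "A \<in> bounded_ops"
  shows "adj A \<in> bounded_ops"
  unfolding bounded_ops_def mem_Collect_eq
proof (intro allI, rule cinner_eqI)
  fix c x y
  have "cinner y (blinfun_apply (adj A) (c *\<^sub>C x)) = cnj c * cinner (blinfun_apply A y) x"
    by (simp only: cinner_adj_right[OF assms, symmetric] cinner_scaleC_right)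
  then show "cinner y (blinfun_apply (adj A) (c *\<^sub>C x)) = cinner y (c *\<^sub>C blinfun_apply (adj A) x)"
    by (simp only: cinner_adj_right[OF assms, symmetric] cinner_scaleC_right)
qed

lemma adj_adj: "A \<in> bounded_ops \<Longrightarrow> adj (adj A) = A"
  by (rule adj_eqI) (simp add: cinner_adj_left)

lemma adj_add: "A \<in> bounded_ops \<Longrightarrow> B \<in> bounded_ops \<Longrightarrow> adj (A + B) = adj A + adj B"
  by (rule adj_eqI) (simp add: blinfun.bilinear_simps cinner_simps cinner_adj_right)

lemma adj_diff: "A \<in> bounded_ops \<Longrightarrow> B \<in> bounded_ops \<Longrightarrow> adj (A - B) = adj A - adj B"
  by (rule adj_eqI) (simp add: blinfun.bilinear_simps cinner_simps cinner_adj_right)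

lemma adj_compose: "A \<in> bounded_ops \<Longrightarrow> B \<in> bounded_ops \<Longrightarrow> adj (A \<odot> B) = adj B \<odot> adj A"
  by (rule adj_eqI) (simp add: cinner_adj_right)

lemma adj_scaleR: "A \<in> bounded_ops \<Longrightarrow> adj (r *\<^sub>R A) = r *\<^sub>R adj A"
  by (rule adj_eqI) (simp add: blinfun.bilinear_simps cinner_simps cinner_adj_right)

lemma adj_scaleC: "A \<in> bounded_ops \<Longrightarrow> adj (op_scaleC c A) = op_scaleC (cnj c) (adj A)"
  by (rule adj_eqI) (simp add: op_scaleC.rep_eq cinner_simps cinner_adj_right)

lemma adj_id: "adj id_blinfun = id_blinfun"
  by (rule adj_eqI) simp

lemma adj_zero: "adj 0 = 0"
  by (rule adj_eqI) (simp add: cinner_simps)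

lemma norm_adj_le: 
  assumes A: "A \<in> bounded_ops" 
  shows "norm (adj A) \<le> norm A"
proof (rule norm_blinfun_bound)
  fix y
  let ?b = "blinfun_apply (adj A) y"
  have "norm ?b * norm ?b = Re (cinner (blinfun_apply A ?b) y)"
    by (simp add: cinner_adj_right A Re_cinner_self power2_eq_square)
  also have "\<dots> \<le> norm (blinfun_apply A ?b) * norm y"
    using Re_cinner_le_norm[of "blinfun_apply A ?b" y] by linarith
  also have "\<dots> \<le> (norm A * norm ?b) * norm y"
    by (intro mult_right_mono norm_blinfun) simp
  finally have "norm ?b * norm ?b \<le> norm ?b * (norm A * norm y)" by (simp add: mult_ac)
  then show "norm ?b \<le> norm A * norm y" by (cases "?b = 0") auto
qed simp

lemma adj_compose_self_eq_zero:
  assumes A: "A \<in> bounded_ops" and "adj A \<odot> A = 0"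
  shows "A = 0"
proof (rule blinfun_eqI)
  fix x
  have "(norm (blinfun_apply A x))\<^sup>2 = Re (cinner x (blinfun_apply (adj A \<odot> A) x))"
    by (simp add: Re_cinner_self flip: cinner_adj_right[OF A])
  then show "blinfun_apply A x = blinfun_apply 0 x" using assms by (simp add: cinner_simps)
qed

section \<open>Ring identities for operators\<close>

lemma op_compose_assoc: "A \<odot> B \<odot> C = A \<odot> (B \<odot> C)"
  by (rule blinfun_eqI) simp

lemma op_id: "id_blinfun \<odot> A = A" "A \<odot> id_blinfun = A"
  by (rule blinfun_eqI; simp)+

lemmas op_ring = bounded_bilinear.add_left[OF bounded_bilinear_blinfun_compose]
  bounded_bilinear.add_right[OF bounded_bilinear_blinfun_compose]
  bounded_bilinear.diff_left[OF bounded_bilinear_blinfun_compose]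
  bounded_bilinear.diff_right[OF bounded_bilinear_blinfun_compose]
  bounded_bilinear.minus_left[OF bounded_bilinear_blinfun_compose]
  bounded_bilinear.minus_right[OF bounded_bilinear_blinfun_compose]
  bounded_bilinear.scaleR_left[OF bounded_bilinear_blinfun_compose]
  bounded_bilinear.scaleR_right[OF bounded_bilinear_blinfun_compose]
  bounded_bilinear.zero_left[OF bounded_bilinear_blinfun_compose]
  bounded_bilinear.zero_right[OF bounded_bilinear_blinfun_compose]
  op_compose_assoc op_id

text \<open>Products are normalised to the right, where a rule for A B no longer matches inside A (B
  D); this supplies the missing instance.\<close>

lemma op_compose_left: "A \<odot> B = C \<Longrightarrow> A \<odot> (B \<odot> D) = C \<odot> D"
  by (simp flip: op_compose_assoc)

lemma op_scaleC_compose_left: "op_scaleC c A \<odot> B = op_scaleC c (A \<odot> B)"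
  by (rule blinfun_eqI) (simp add: op_scaleC.rep_eq)

lemma op_scaleC_compose_right: "A \<in> bounded_ops \<Longrightarrow> A \<odot> op_scaleC c B = op_scaleC c (A \<odot> B)"
  by (rule blinfun_eqI) (simp add: op_scaleC.rep_eq bounded_opsD)

lemma op_scaleC_of_real: "op_scaleC (complex_of_real r) A = r *\<^sub>R A"
  by (rule blinfun_eqI) (simp add: op_scaleC.rep_eq blinfun.bilinear_simps scaleR_scaleC)

lemma op_scaleC_op_scaleC: "op_scaleC c (op_scaleC d A) = op_scaleC (c * d) A"
  by (rule blinfun_eqI) (simp add: op_scaleC.rep_eq scaleC_scaleC)

lemma op_scaleC_add_left: "op_scaleC (c + d) A = op_scaleC c A + op_scaleC d A"
  by (rule blinfun_eqI) (simp add: op_scaleC.rep_eq blinfun.bilinear_simps scaleC_add_left)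

section \<open>Projections in von Neumann algebras\<close>

primrec sqrt_seq :: "('h::real_normed_vector \<Rightarrow>\<^sub>L 'h) \<Rightarrow> nat \<Rightarrow> ('h \<Rightarrow>\<^sub>L 'h)" where
  "sqrt_seq b 0 = 0"
| "sqrt_seq b (Suc n) = (1/2) *\<^sub>R (sqrt_seq b n \<odot> sqrt_seq b n + b)"

primrec sqrt_majorant :: "nat \<Rightarrow> real" where
  "sqrt_majorant 0 = 0"
| "sqrt_majorant (Suc n) = ((sqrt_majorant n)\<^sup>2 + 1) / 2"

lemma sqrt_majorant_bounds: "0 \<le> sqrt_majorant n \<and> sqrt_majorant n \<le> 1"
proof (induction n)
  case (Suc n)
  then have "(sqrt_majorant n)\<^sup>2 \<le> 1" by (simp add: power_le_one)
  then show ?case by simp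
qed simp

lemma incseq_sqrt_majorant: "incseq sqrt_majorant"
proof (rule incseq_SucI)
  fix n
  have "0 \<le> (sqrt_majorant n - 1)\<^sup>2" by simp
  then show "sqrt_majorant n \<le> sqrt_majorant (Suc n)" by (simp add: power2_eq_square algebra_simps)
qed

primrec op_power :: "('h::real_normed_vector \<Rightarrow>\<^sub>L 'h) \<Rightarrow> nat \<Rightarrow> ('h \<Rightarrow>\<^sub>L 'h)" where
  "op_power T 0 = id_blinfun"
| "op_power T (Suc n) = T \<odot> op_power T n"

section \<open>Closure properties of a von Neumann algebra\<close>

locale vn_algebra =
  fixes M :: "('h::chilbert_space \<Rightarrow>\<^sub>L 'h) set"
  assumes von_neumann: "von_neumann_algebra M"
begin

lemma bounded_ops [simp]: "A \<in> M \<Longrightarrow> A \<in> bounded_ops"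
  and id_mem [simp]: "id_blinfun \<in> M"
  and add_mem [simp]: "A \<in> M \<Longrightarrow> B \<in> M \<Longrightarrow> A + B \<in> M"
  and scaleC_mem [simp]: "A \<in> M \<Longrightarrow> op_scaleC c A \<in> M"
  and compose_mem [simp]: "A \<in> M \<Longrightarrow> B \<in> M \<Longrightarrow> A \<odot> B \<in> M"
  and adj_mem [simp]: "A \<in> M \<Longrightarrow> adj A \<in> M"
  using von_neumann by (auto simp: von_neumann_algebra_def)

lemma scaleR_mem [simp]: "A \<in> M \<Longrightarrow> r *\<^sub>R A \<in> M"
  by (metis op_scaleC_of_real scaleC_mem)

lemma zero_mem [simp]: "0 \<in> M"
  using scaleR_mem[of id_blinfun 0] by simp

lemma minus_mem [simp]: "A \<in> M \<Longrightarrow> - A \<in> M"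
  using scaleR_mem[of A "-1"] by simp

lemma diff_mem [simp]: "A \<in> M \<Longrightarrow> B \<in> M \<Longrightarrow> A - B \<in> M"
  using add_mem[of A "- B"] by simp

lemma adj_adj_mem [simp]: "A \<in> M \<Longrightarrow> adj (adj A) = A"
  by (simp add: adj_adj)

lemmas adj_simps [simp] = adj_add[OF bounded_ops bounded_ops] adj_diff[OF bounded_ops bounded_ops]
  adj_compose[OF bounded_ops bounded_ops] adj_scaleR[OF bounded_ops] adj_id adj_zero

text \<open>Strong convergence implies convergence of every coefficient <T x, y>, that is, of the
  images in the function space from which the weak-operator topology is pulled back.\<close>

lemma strong_limit_mem:
  assumes T: "\<And>n::nat. T n \<in> M"
    and lim: "\<And>x. (\<lambda>n. blinfun_apply (T n) x) \<longlonglongrightarrow> blinfun_apply L x"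
  shows "L \<in> M"
proof (rule ccontr)
  assume "L \<notin> M"
  \<comment> \<open>The topology lives on \<open>bounded_ops\<close>, so complex linearity of the
    limit has to be known before L can be placed in the complement of M.\<close>
  have L: "L \<in> bounded_ops"
    unfolding bounded_ops_def mem_Collect_eq
  proof (intro allI)
    fix c x
    have "(\<lambda>n. blinfun_apply (T n) (c *\<^sub>C x)) \<longlonglongrightarrow> c *\<^sub>C blinfun_apply L x"
      by (simp add: bounded_opsD[OF bounded_ops[OF T]] tendsto_scaleC lim)
    then show "blinfun_apply L (c *\<^sub>C x) = c *\<^sub>C blinfun_apply L x"
      using lim LIMSEQ_unique by blast
  qed
  define f :: "('h \<Rightarrow>\<^sub>L 'h) \<Rightarrow> 'h \<times> 'h \<Rightarrow> complex"
    where "f = (\<lambda>T (x, y). cinner (blinfun_apply T x) y)"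
  have "openin (pullback_topology bounded_ops f euclidean)
    (topspace (pullback_topology bounded_ops f euclidean) - M)"
    using von_neumann
    unfolding von_neumann_algebra_def weak_operator_topology_def f_def closedin_def by blast
  then obtain U where U: "open U" "bounded_ops - M = f -` U \<inter> bounded_ops"
    unfolding openin_pullback_topology topspace_pullback_topology by auto
  have "(\<lambda>n. f (T n) xy) \<longlonglongrightarrow> f L xy" for xy
    unfolding f_def by (cases xy) (auto intro: tendsto_cinner_left lim)
  then have "limitin (product_topology (\<lambda>_. euclidean) UNIV) (\<lambda>n. f (T n)) (f L) sequentially"
    by (auto simp: limitin_componentwise)
  then have "(\<lambda>n. f (T n)) \<longlonglongrightarrow> f L"
    by (simp add: euclidean_product_topology)
  moreover have "f L \<in> U" using U(2) L \<open>L \<notin> M\<close> by auto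
  ultimately have "eventually (\<lambda>n. f (T n) \<in> U) sequentially"
    using U(1) topological_tendstoD by blast
  then obtain n where "f (T n) \<in> U" by (auto simp: eventually_sequentially)
  then have "T n \<in> bounded_ops - M" using U(2) T by auto
  then show False using T by blast
qed

lemma norm_limit_mem:
  assumes "\<And>n::nat. T n \<in> M" and "T \<longlonglongrightarrow> L"
  shows "L \<in> M"
  using assms(1) by (rule strong_limit_mem) (rule blinfun.tendsto[OF assms(2) tendsto_const])

lemma complete: "complete M"
  unfolding complete_eq_closed closed_sequential_limits using norm_limit_mem by blast

lemma adj_tendsto:
  assumes "\<And>n::nat. T n \<in> M" and "T \<longlonglongrightarrow> L"
  shows "(\<lambda>n. adj (T n)) \<longlonglongrightarrow> adj L"
proof -
  have L: "L \<in> M" by (rule norm_limit_mem) (rule assms)+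
  have "(\<lambda>n. norm (T n - L)) \<longlonglongrightarrow> 0"
    using assms(2) by (simp add: LIM_zero_iff tendsto_norm_zero_iff)
  then have "(\<lambda>n. adj (T n) - adj L) \<longlonglongrightarrow> 0"
  proof (rule Lim_null_comparison[rotated])
    show "\<forall>\<^sub>F n in sequentially. norm (adj (T n) - adj L) \<le> norm (T n - L)"
      using norm_adj_le[of "T _ - L"] assms(1) L by simp
  qed
  then show ?thesis by (simp add: LIM_zero_iff)
qed

text \<open>The solution \<open>c\<close> is \<open>1 - sqrt (1 - b)\<close>. The iteration is dominated by the same iteration
  for the scalar \<open>b = 1\<close>, so it converges in norm even at the boundary \<open>\<parallel>b\<parallel> = 1\<close>.\<close>

lemma one_minus_sqrt:
  assumes b: "b \<in> M" "adj b = b" "norm b \<le> 1"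
  obtains c where "c \<in> M" "adj c = c" "norm c \<le> 1" "2 *\<^sub>R c = c \<odot> c + b"
    "\<And>a. a \<odot> b = b \<odot> a \<Longrightarrow> a \<odot> c = c \<odot> a"
proof -
  let ?c = "sqrt_seq b" and ?g = sqrt_majorant
  have mem: "?c n \<in> M" for n by (induction n) (simp_all add: b)
  have sa: "adj (?c n) = ?c n" for n by (induction n) (simp_all add: b mem)
  have bound: "norm (?c n) \<le> ?g n" for n
  proof (induction n)
    case (Suc n)
    have "norm (?c n \<odot> ?c n + b) \<le> norm (?c n) * norm (?c n) + 1"
      using norm_triangle_ineq[of "?c n \<odot> ?c n" b] norm_blinfun_compose[of "?c n" "?c n"] b(3)
      by linarith
    also have "\<dots> \<le> (?g n)\<^sup>2 + 1"
      using mult_mono'[OF Suc Suc] by (simp add: power2_eq_square)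
    finally show ?case by simp
  qed simp
  have step: "norm (?c (Suc n) - ?c n) \<le> ?g (Suc n) - ?g n" for n
  proof (induction n)
    case 0
    then show ?case using b(3) by simp
  next
    case (Suc n)
    let ?d = "?c (Suc n) - ?c n" and ?h = "?g (Suc n) - ?g n"
    \<comment> \<open>The factorisation u^2 - v^2 = u (u - v) + (u - v) v requires no
      commutativity.\<close>
    have "?c (Suc (Suc n)) - ?c (Suc n) = (1/2) *\<^sub>R (?c (Suc n) \<odot> ?d + ?d \<odot> ?c n)"
      unfolding sqrt_seq.simps(2)[of b "Suc n"]
      by (subst (3) sqrt_seq.simps(2)) (simp add: op_ring algebra_simps del: sqrt_seq.simps(2))
    then have "norm (?c (Suc (Suc n)) - ?c (Suc n))
        \<le> (norm (?c (Suc n) \<odot> ?d) + norm (?d \<odot> ?c n)) / 2"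
      using norm_triangle_ineq[of "?c (Suc n) \<odot> ?d" "?d \<odot> ?c n"] by simp
    also have "\<dots> \<le> (norm (?c (Suc n)) * norm ?d + norm ?d * norm (?c n)) / 2"
      by (intro divide_right_mono add_mono norm_blinfun_compose) simp
    also have "\<dots> \<le> (?g (Suc n) * ?h + ?h * ?g n) / 2"
      using incseq_SucD[OF incseq_sqrt_majorant, of n] sqrt_majorant_bounds[of "Suc n"]
      by (intro divide_right_mono add_mono mult_mono Suc bound) (linarith | simp)+
    also have "\<dots> = ((?g (Suc n))\<^sup>2 + 1) / 2 - ((?g n)\<^sup>2 + 1) / 2"
      by (simp add: power2_eq_square field_simps del: sqrt_majorant.simps(2))
    also have "\<dots> = ?g (Suc (Suc n)) - ?g (Suc n)"
      by (simp only: sqrt_majorant.simps(2))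
    finally show ?case .
  qed
  have tele: "norm (?c (n + k) - ?c n) \<le> ?g (n + k) - ?g n" for n k
  proof (induction k)
    case (Suc k)
    then show ?case
      using norm_triangle_ineq[of "?c (Suc (n + k)) - ?c (n + k)" "?c (n + k) - ?c n"]
        step[of "n + k"] by (simp del: sqrt_seq.simps(2) sqrt_majorant.simps(2))
  qed simp
  obtain G where "?g \<longlonglongrightarrow> G"
    by (rule incseq_convergent[OF incseq_sqrt_majorant, of 1]) (auto simp: sqrt_majorant_bounds)
  then have g: "Cauchy ?g" by (rule LIMSEQ_imp_Cauchy)
  have "Cauchy ?c"
  proof (rule CauchyI')
    fix e :: real
    assume "0 < e"
    with g obtain N where N: "\<And>m n. m \<ge> N \<Longrightarrow> n \<ge> N \<Longrightarrow> \<bar>?g m - ?g n\<bar> < e"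
      unfolding Cauchy_iff by (metis real_norm_def)
    show "\<exists>N. \<forall>m\<ge>N. \<forall>n>m. dist (?c m) (?c n) < e"
    proof (intro exI allI impI)
      fix m n assume "N \<le> m" "m < n"
      then show "dist (?c m) (?c n) < e"
        using tele[of m "n - m"] N[of n m] by (simp add: dist_norm norm_minus_commute)
    qed
  qed
  then obtain c where c: "?c \<longlonglongrightarrow> c" using convergentD Cauchy_convergent_iff by blast
  have lim: "(\<lambda>n. A \<odot> ?c n) \<longlonglongrightarrow> A \<odot> c" "(\<lambda>n. ?c n \<odot> A) \<longlonglongrightarrow> c \<odot> A" for A
    by (intro bounded_bilinear.tendsto[OF bounded_bilinear_blinfun_compose] tendsto_const c)+
  show thesis
  proof (rule that)
    show "c \<in> M" using mem c by (rule norm_limit_mem)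
    show "adj c = c" using adj_tendsto[OF mem c] c LIMSEQ_unique by (simp add: sa) blast
    show "norm c \<le> 1"
      by (rule LIMSEQ_le_const2[OF tendsto_norm[OF c]])
        (use bound sqrt_majorant_bounds order_trans in blast)
    have "(\<lambda>n. 2 *\<^sub>R ?c (Suc n)) \<longlonglongrightarrow> 2 *\<^sub>R c"
      by (intro tendsto_intros LIMSEQ_Suc c)
    moreover have "(\<lambda>n. 2 *\<^sub>R ?c (Suc n)) \<longlonglongrightarrow> c \<odot> c + b"
      by simp (intro tendsto_intros bounded_bilinear.tendsto[OF bounded_bilinear_blinfun_compose] c)
    ultimately show "2 *\<^sub>R c = c \<odot> c + b" by (rule LIMSEQ_unique)
    fix a assume ab: "a \<odot> b = b \<odot> a"
    have "a \<odot> ?c n = ?c n \<odot> a" for n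
    proof (induction n)
      case (Suc n)
      have "a \<odot> (?c n \<odot> ?c n) = ?c n \<odot> a \<odot> ?c n" by (simp add: Suc flip: op_compose_assoc)
      also have "\<dots> = ?c n \<odot> ?c n \<odot> a" by (simp add: op_compose_assoc Suc)
      finally show ?case by (simp add: op_ring ab)
    qed simp
    then show "a \<odot> c = c \<odot> a" using lim[of a] LIMSEQ_unique by simp
  qed
qed

section \<open>Projections onto fixed spaces and ranges\<close>

definition projection :: "('h \<Rightarrow>\<^sub>L 'h) \<Rightarrow> bool" where
  "projection e \<longleftrightarrow> e \<in> M \<and> e \<odot> e = e \<and> adj e = e"

lemma projection_compl: "projection e \<Longrightarrow> projection (id_blinfun - e)"
  by (simp add: projection_def op_ring)

lemma projectionI: "e \<in> M \<Longrightarrow> e \<odot> e = e \<Longrightarrow> adj e = e \<Longrightarrow> projection e"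
  by (simp add: projection_def)

lemma projection_mem [simp]: "projection e \<Longrightarrow> e \<in> M"
  and projection_idem [simp]: "projection e \<Longrightarrow> e \<odot> e = e"
  and projection_adj [simp]: "projection e \<Longrightarrow> adj e = e"
  by (simp_all add: projection_def)

lemma projection_idem_left [simp]: "projection e \<Longrightarrow> e \<odot> (e \<odot> A) = e \<odot> A"
  by (simp flip: op_compose_assoc)

text \<open>Since \<open>\<langle>T\<^sup>2\<^sup>n x, T\<^sup>2\<^sup>m x\<rangle> = \<parallel>T\<^sup>n\<^sup>+\<^sup>m x\<parallel>\<^sup>2\<close> and this is decreasing in \<open>n + m\<close>, the even powers
  of \<open>T\<close> converge strongly.\<close>

lemma fixed_space_projection:
  assumes T: "T \<in> M" "adj T = T" "norm T \<le> 1"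
  obtains P where "projection P" "T \<odot> (T \<odot> P) = P"
    "\<And>x. blinfun_apply T x = x \<Longrightarrow> blinfun_apply P x = x"
proof -
  let ?T = "\<lambda>n x. blinfun_apply (op_power T n) x"
  have mem: "op_power T n \<in> M" for n by (induction n) (simp_all add: T)
  have add: "?T (m + n) x = ?T m (?T n x)" for m n x by (induction m) simp_all
  have ip: "cinner (?T m x) (?T n y) = cinner x (?T (m + n) y)" for m n x y
  proof (induction m arbitrary: n)
    case (Suc m)
    have "cinner (?T (Suc m) x) (?T n y) = cinner (?T m x) (?T (Suc n) y)"
      by (simp add: cinner_adj_right[OF bounded_ops[OF T(1)]] T(2))
    then show ?case using Suc[of "Suc n"] by simp
  qed simp
  have contr: "norm (blinfun_apply T x) \<le> norm x" for x
    using norm_blinfun[of T x] T(3) mult_right_mono[OF T(3), of "norm x"] by simp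
  define a where "a x n = (norm (?T n x))\<^sup>2" for x n
  \<comment> \<open>Only even powers are used: T may act as -1 on a subspace, where its powers
    alternate.\<close>
  have "\<exists>L. (\<lambda>n. ?T (2 * n) x) \<longlonglongrightarrow> L" for x
  proof -
    have "decseq (a x)"
      by (rule decseq_SucI) (simp add: a_def power_mono contr)
    then obtain L where L: "a x \<longlonglongrightarrow> L"
      by (rule decseq_convergent[of _ 0]) (auto simp: a_def)
    have diff: "(norm (?T (2 * m) x - ?T (2 * n) x))\<^sup>2 = a x (2 * m) + a x (2 * n) - 2 * a x (m + n)" for m n
    proof -
      have "cinner (?T (2 * m) x) (?T (2 * n) x) = cinner (?T (m + n) x) (?T (m + n) x)"
        unfolding ip by (rule arg_cong[where f = "\<lambda>k. cinner x (?T k x)"]) simp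
      then show ?thesis by (simp add: norm_diff_cinner a_def Re_cinner_self)
    qed
    have "Cauchy (\<lambda>n. ?T (2 * n) x)"
    proof (rule metric_CauchyI)
      fix e :: real assume e: "e > 0"
      then have "e\<^sup>2 / 4 > 0" by simp
      with L obtain N where N: "\<And>n. n \<ge> N \<Longrightarrow> \<bar>a x n - L\<bar> < e\<^sup>2 / 4"
        unfolding LIMSEQ_iff by (metis real_norm_def)
      show "\<exists>N. \<forall>m\<ge>N. \<forall>n\<ge>N. dist (?T (2 * m) x) (?T (2 * n) x) < e"
      proof (intro exI allI impI)
        fix m n assume mn: "N \<le> m" "N \<le> n"
        then have "\<bar>a x (2 * m) - L\<bar> < e\<^sup>2 / 4" "\<bar>a x (2 * n) - L\<bar> < e\<^sup>2 / 4" "\<bar>a x (m + n) - L\<bar> < e\<^sup>2 / 4"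
          by (intro N; simp)+
        then have "(norm (?T (2 * m) x - ?T (2 * n) x))\<^sup>2 < e\<^sup>2" unfolding diff by linarith
        then show "dist (?T (2 * m) x) (?T (2 * n) x) < e"
          using e by (auto simp: dist_norm intro: power2_less_imp_less)
      qed
    qed
    then show ?thesis using convergentD Cauchy_convergent_iff by blast
  qed
  then obtain p where p: "\<And>x. (\<lambda>n. ?T (2 * n) x) \<longlonglongrightarrow> p x" by metis
  have pow_contr: "norm (?T n x) \<le> norm x" for n x
    by (induction n) (auto intro: order_trans[OF contr])
  have "bounded_linear p"
  proof (rule bounded_linear_intro[where K = 1])
    show "p (x + y) = p x + p y" for x y
      using p[of "x + y"] tendsto_add[OF p[of x] p[of y]] LIMSEQ_unique
      by (simp add: blinfun.bilinear_simps) blast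
    show "p (r *\<^sub>R x) = r *\<^sub>R p x" for r x
      using p[of "r *\<^sub>R x"] tendsto_scaleR[OF tendsto_const p[of x], of r] LIMSEQ_unique
      by (simp add: blinfun.bilinear_simps) blast
    show "norm (p x) \<le> norm x * 1" for x
      using LIMSEQ_le_const2[OF tendsto_norm[OF p[of x]]] pow_contr by auto
  qed
  then have "\<exists>P. blinfun_apply P = p" by (metis bounded_linear_Blinfun_apply)
  then obtain P where P: "\<And>x. (\<lambda>n. ?T (2 * n) x) \<longlonglongrightarrow> blinfun_apply P x" using p by metis
  have fixI: "blinfun_apply P x = x" if "\<And>n. ?T (2 * n) x = x" for x
    using P[of x] that by (simp add: LIMSEQ_const_iff)
  have TTP: "blinfun_apply T (blinfun_apply T (blinfun_apply P x)) = blinfun_apply P x" for x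
  proof -
    have "(\<lambda>n. blinfun_apply T (blinfun_apply T (?T (2 * n) x))) \<longlonglongrightarrow>
        blinfun_apply T (blinfun_apply T (blinfun_apply P x))"
      by (intro blinfun.tendsto tendsto_const P)
    moreover have "(\<lambda>n. blinfun_apply T (blinfun_apply T (?T (2 * n) x))) \<longlonglongrightarrow> blinfun_apply P x"
      using LIMSEQ_Suc[OF P[of x]] by simp
    ultimately show ?thesis by (rule LIMSEQ_unique)
  qed
  show thesis
  proof (rule that)
    have "P \<in> M" by (rule strong_limit_mem[of "\<lambda>n. op_power T (2 * n)"]) (auto simp: mem P)
    moreover have "adj P = P"
    proof (rule adj_eqI)
      fix x y
      have "(\<lambda>n. cinner (?T (2 * n) x) y) \<longlonglongrightarrow> cinner (blinfun_apply P x) y"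
        by (intro tendsto_cinner_left P)
      moreover have "(\<lambda>n. cinner (?T (2 * n) x) y) \<longlonglongrightarrow> cinner x (blinfun_apply P y)"
        using tendsto_cinner_right[OF P[of y], of x] ip[of "2 * _" x 0 y] by simp
      ultimately show "cinner (blinfun_apply P x) y = cinner x (blinfun_apply P y)"
        by (rule LIMSEQ_unique)
    qed
    moreover have "P \<odot> P = P"
    proof (rule blinfun_eqI)
      fix x
      have "?T (2 * n) (blinfun_apply P x) = blinfun_apply P x" for n
        by (induction n) (simp_all add: TTP)
      then show "blinfun_apply (P \<odot> P) x = blinfun_apply P x" by (simp add: fixI)
    qed
    ultimately show "projection P" by (intro projectionI)
    show "T \<odot> (T \<odot> P) = P" by (rule blinfun_eqI) (simp add: TTP)
    fix x assume "blinfun_apply T x = x"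
    then have "?T n x = x" for n by (induction n) simp_all
    then show "blinfun_apply P x = x" by (simp add: fixI)
  qed
qed

text \<open>For small k > 0 the operator 1 - k A A* is a self-adjoint contraction, and its square
  fixes exactly the kernel of A*. The complement of the projection onto that kernel projects onto
  the closed range of A.\<close>

lemma range_projection:
  assumes A: "A \<in> M"
  obtains p where "projection p" "p \<odot> A = A"
    "\<And>X. X \<in> bounded_ops \<Longrightarrow> X \<odot> A = 0 \<Longrightarrow> X \<odot> p = 0"
proof -
  \<comment> \<open>The choice gives k ||A||^2 \<le> 1, which makes T a contraction; the summand 1
    covers A = 0.\<close>
  define k where "k = 1 / (1 + (norm A)\<^sup>2)"
  have k0: "k > 0" by (simp add: k_def add_pos_nonneg)
  have k: "k * (norm A)\<^sup>2 \<le> 1" by (simp add: k_def divide_le_eq add_pos_nonneg)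
  define T where "T = id_blinfun - k *\<^sub>R (A \<odot> adj A)"
  have T: "T \<in> M" "adj T = T" using A by (simp_all add: T_def)
  let ?a = "\<lambda>x. blinfun_apply (adj A) x"
  have Tx: "blinfun_apply T x = x - k *\<^sub>R blinfun_apply A (?a x)" for x
    by (simp add: T_def blinfun.bilinear_simps)
  have main: "(norm (blinfun_apply T x))\<^sup>2 \<le> (norm x)\<^sup>2 - k * (norm (?a x))\<^sup>2" for x
  proof -
    have "Re (cinner x (blinfun_apply A (?a x))) = Re (cinner (blinfun_apply A (?a x)) x)"
      by (rule Re_cinner_commute)
    also have "\<dots> = (norm (?a x))\<^sup>2"
      by (simp add: Re_cinner_self cinner_adj_right[OF bounded_ops[OF A]])
    finally have "(norm (blinfun_apply T x))\<^sup>2 =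
        (norm x)\<^sup>2 + k\<^sup>2 * (norm (blinfun_apply A (?a x)))\<^sup>2 - 2 * k * (norm (?a x))\<^sup>2"
      using k0 by (simp add: Tx norm_diff_cinner cinner_simps power_mult_distrib)
    moreover have "k\<^sup>2 * (norm (blinfun_apply A (?a x)))\<^sup>2 \<le> k * (norm (?a x))\<^sup>2"
    proof -
      have "(norm (blinfun_apply A (?a x)))\<^sup>2 \<le> (norm A)\<^sup>2 * (norm (?a x))\<^sup>2"
        using power_mono[OF norm_blinfun[of A "?a x"], of 2] by (simp add: power_mult_distrib)
      then have "k\<^sup>2 * (norm (blinfun_apply A (?a x)))\<^sup>2 \<le> k\<^sup>2 * ((norm A)\<^sup>2 * (norm (?a x))\<^sup>2)"
        by (intro mult_left_mono) simp_all
      also have "\<dots> = (k * (norm A)\<^sup>2) * (k * (norm (?a x))\<^sup>2)"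
        by (simp add: power2_eq_square)
      also have "\<dots> \<le> 1 * (k * (norm (?a x))\<^sup>2)"
        using k0 by (intro mult_right_mono k) simp
      finally show ?thesis by simp
    qed
    ultimately show ?thesis by linarith
  qed
  have contr: "norm (blinfun_apply T x) \<le> norm x" for x
  proof (rule power2_le_imp_le)
    have "0 \<le> k * (norm (?a x))\<^sup>2" using k0 by simp
    then show "(norm (blinfun_apply T x))\<^sup>2 \<le> (norm x)\<^sup>2" using main[of x] by linarith
  qed simp
  then have "norm T \<le> 1" by (intro norm_blinfun_bound) simp_all
  with T obtain P where P: "projection P" "T \<odot> (T \<odot> P) = P"
    "\<And>x. blinfun_apply T x = x \<Longrightarrow> blinfun_apply P x = x"
    using fixed_space_projection by blast
  \<comment> \<open>A vector fixed by T^2 loses no norm in the first application of T, and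
    \<open>main\<close> bounds k ||A* x||^2 by that loss.\<close>
  have ker: "?a x = 0" if "blinfun_apply T (blinfun_apply T x) = x" for x
  proof -
    have "(norm x)\<^sup>2 \<le> (norm (blinfun_apply T x))\<^sup>2"
      using contr[of "blinfun_apply T x"] that by (simp add: power_mono)
    then have "k * (norm (?a x))\<^sup>2 \<le> 0" using main[of x] by linarith
    then show ?thesis using k0 by (simp add: mult_le_0_iff)
  qed
  have "adj A \<odot> P = 0"
  proof (rule blinfun_eqI)
    fix x
    have "blinfun_apply T (blinfun_apply T (blinfun_apply P x)) = blinfun_apply P x"
      using arg_cong[OF P(2), of "\<lambda>S. blinfun_apply S x"] by simp
    then show "blinfun_apply (adj A \<odot> P) x = blinfun_apply 0 x" by (simp add: ker)
  qed
  then have "adj (adj A \<odot> P) = 0" by simp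
  then have PA: "P \<odot> A = 0" using P(1) A by simp
  show thesis
  proof (rule that)
    show "projection (id_blinfun - P)" using P(1) by (rule projection_compl)
    show "(id_blinfun - P) \<odot> A = A" by (simp add: op_ring PA)
    fix X assume X: "X \<in> bounded_ops" "X \<odot> A = 0"
    have "adj A \<odot> adj X = 0" using adj_compose[OF X(1) bounded_ops[OF A]] X(2) by simp
    then have "?a (blinfun_apply (adj X) x) = 0" for x
      by (metis blinfun_apply_blinfun_compose blinfun.zero_left)
    then have "P \<odot> adj X = adj X"
      by (intro blinfun_eqI) (simp add: P(3) Tx blinfun.bilinear_simps)
    then have "adj (P \<odot> adj X) = adj (adj X)" by simp
    then have "X \<odot> P = X"
      using P(1) X(1) by (simp add: adj_compose adj_bounded_ops adj_adj)
    then show "X \<odot> (id_blinfun - P) = 0" by (simp add: op_ring)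
  qed
qed

section \<open>Absolute values, commutators and the type I_1 condition\<close>

lemma norm_reflection_compose_le:
  assumes e: "projection e"
  shows "norm ((2 *\<^sub>R e - id_blinfun) \<odot> A) \<le> norm A"
proof -
  let ?g = "2 *\<^sub>R e - id_blinfun"
  have g: "?g \<in> M" "adj ?g = ?g" using e by simp_all
  \<comment> \<open>A self-adjoint square root of 1 is isometric.\<close>
  have gg: "?g \<odot> ?g = id_blinfun" using e by (simp add: op_ring scaleR_2)
  have "norm (blinfun_apply ?g x) \<le> norm x" for x
  proof (rule power2_le_imp_le)
    have "(norm (blinfun_apply ?g x))\<^sup>2 = Re (cinner x (blinfun_apply (?g \<odot> ?g) x))"
      by (simp add: cinner_adj_right[OF bounded_ops[OF g(1)]] g(2) flip: Re_cinner_self)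
    then show "(norm (blinfun_apply ?g x))\<^sup>2 \<le> (norm x)\<^sup>2" by (simp add: gg Re_cinner_self)
  qed simp
  then have "norm ?g \<le> 1" by (intro norm_blinfun_bound) simp_all
  then show ?thesis
    using norm_blinfun_compose[of ?g A] mult_right_mono[of "norm ?g" 1 "norm A"] by simp
qed

text \<open>Here \<open>s\<close> is the absolute value of \<open>h\<close>, and the last bound says \<open>0 \<le> s \<le> 1\<close>.\<close>

lemma absolute_value:
  assumes h: "h \<in> M" "adj h = h" "norm h \<le> 1"
  obtains e s where "projection e" "s \<in> M" "adj s = s" "h = (2 *\<^sub>R e - id_blinfun) \<odot> s"
    "norm (2 *\<^sub>R s - id_blinfun) \<le> 1"
proof -
  let ?q = "\<lambda>A x. Re (cinner x (blinfun_apply A x))"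
  have sa: "cinner (blinfun_apply A x) y = cinner x (blinfun_apply A y)"
    if "A \<in> M" "adj A = A" for A x y
    using cinner_adj_right[OF bounded_ops[OF that(1)]] that(2) by simp
  have contr: "norm (blinfun_apply h x) \<le> norm x" for x
    using norm_blinfun[of h x] mult_right_mono[OF h(3), of "norm x"] by simp
  \<comment> \<open>Chosen so that 1 - b = h^2; then 1 - c is a square root of h^2.\<close>
  define b where "b = id_blinfun - h \<odot> h"
  have b: "b \<in> M" "adj b = b" using h by (simp_all add: b_def)
  have sq: "Re (cinner x (blinfun_apply A (blinfun_apply A x))) = (norm (blinfun_apply A x))\<^sup>2"
    if "A \<in> M" "adj A = A" for A x
    by (subst sa[OF that, symmetric]) (rule Re_cinner_self)
  note qhh = sq[OF h(1,2)]
  have "norm b \<le> 1"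
  proof (rule norm_blinfun_bound)
    fix x
    have "(norm (blinfun_apply b x))\<^sup>2 =
        (norm x)\<^sup>2 + (norm (blinfun_apply h (blinfun_apply h x)))\<^sup>2 - 2 * (norm (blinfun_apply h x))\<^sup>2"
      by (simp add: b_def blinfun.bilinear_simps norm_diff_cinner qhh)
    moreover have "(norm (blinfun_apply h (blinfun_apply h x)))\<^sup>2 \<le> (norm (blinfun_apply h x))\<^sup>2"
      by (intro power_mono contr) simp
    moreover have "0 \<le> (norm (blinfun_apply h x))\<^sup>2" by simp
    ultimately have "(norm (blinfun_apply b x))\<^sup>2 \<le> (norm x)\<^sup>2" by linarith
    then show "norm (blinfun_apply b x) \<le> 1 * norm x" by (simp add: power2_le_iff_abs_le)
  qed simp
  with b obtain c where c: "c \<in> M" "adj c = c" "norm c \<le> 1" "2 *\<^sub>R c = c \<odot> c + b"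
    "\<And>a. a \<odot> b = b \<odot> a \<Longrightarrow> a \<odot> c = c \<odot> a"
    using one_minus_sqrt by blast
  define s where "s = id_blinfun - c"
  have s: "s \<in> M" "adj s = s" using c(1,2) by (simp_all add: s_def)
  have "h \<odot> c = c \<odot> h" by (rule c) (simp add: b_def op_ring)
  then have hs: "h \<odot> s = s \<odot> h" by (simp add: s_def op_ring)
  have "s \<odot> s = id_blinfun - 2 *\<^sub>R c + c \<odot> c" by (simp add: s_def op_ring scaleR_2)
  then have ss: "s \<odot> s = h \<odot> h" by (simp add: c(4) b_def)
  \<comment> \<open>The sum s + h is twice the positive part of h. Since s and h commute and have
    equal squares, s - h annihilates its range, so h agrees with s under e and with -s under 1 -
    e.\<close>
  obtain e where e: "projection e" "e \<odot> (s + h) = s + h"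
    "\<And>X. X \<in> bounded_ops \<Longrightarrow> X \<odot> (s + h) = 0 \<Longrightarrow> X \<odot> e = 0"
    using range_projection[OF add_mem[OF s(1) h(1)]] by blast
  have "(s - h) \<odot> e = 0"
    by (rule e) (use s h in \<open>simp_all add: op_ring hs ss\<close>)
  then have "adj ((s - h) \<odot> e) = 0" by simp
  then have "e \<odot> s = e \<odot> h" using e(1) s h by (simp add: op_ring)
  with e(2) have hes: "h = (2 *\<^sub>R e - id_blinfun) \<odot> s"
    by (simp add: op_ring scaleR_2 algebra_simps)
  have cpos: "0 \<le> ?q c x" for x
  proof -
    have "?q (2 *\<^sub>R c) x = (norm (blinfun_apply c x))\<^sup>2 + ((norm x)\<^sup>2 - (norm (blinfun_apply h x))\<^sup>2)"
      unfolding c(4)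
      by (simp add: b_def blinfun.bilinear_simps cinner_simps qhh sq[OF c(1,2)] Re_cinner_self)
    moreover have "(norm (blinfun_apply h x))\<^sup>2 \<le> (norm x)\<^sup>2" by (intro power_mono contr) simp
    ultimately have "0 \<le> ?q (2 *\<^sub>R c) x" by simp
    then show ?thesis by (simp add: blinfun.bilinear_simps cinner_simps)
  qed
  have spos: "0 \<le> ?q s x" for x
  proof -
    have "norm (blinfun_apply c x) \<le> norm x"
      using norm_blinfun[of c x] mult_right_mono[OF c(3), of "norm x"] by simp
    then have "norm x * norm (blinfun_apply c x) \<le> norm x * norm x" by (intro mult_left_mono) simp_all
    then have "?q c x \<le> (norm x)\<^sup>2"
      using Re_cinner_le_norm[of x "blinfun_apply c x"] by (simp add: power2_eq_square)
    then show ?thesis by (simp add: s_def blinfun.bilinear_simps cinner_simps Re_cinner_self)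
  qed
  \<comment> \<open>As s + c = 1, the product s c is a sum of conjugates of positive operators. Its
    positivity is s^2 \<le> s, which is equivalent to (2s - 1)^2 \<le> 1.\<close>
  have sc: "s \<odot> c = s \<odot> (c \<odot> s) + c \<odot> (s \<odot> c)"
    by (simp add: s_def op_ring)
  have "?q (s \<odot> c) x = ?q c (blinfun_apply s x) + ?q s (blinfun_apply c x)" for x
    by (subst sc) (simp add: blinfun.bilinear_simps cinner_simps sa[OF s] sa[OF c(1,2)])
  moreover have "s \<odot> c = s - s \<odot> s" by (simp add: s_def op_ring)
  ultimately have "0 \<le> ?q (s - s \<odot> s) x" for x using cpos spos by simp
  then have le: "(norm (blinfun_apply s x))\<^sup>2 \<le> ?q s x" for x
    by (simp add: blinfun.bilinear_simps cinner_simps sq[OF s])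
  have "norm (2 *\<^sub>R s - id_blinfun) \<le> 1"
  proof (rule norm_blinfun_bound)
    fix x
    have "(norm (blinfun_apply (2 *\<^sub>R s - id_blinfun) x))\<^sup>2 =
        4 * (norm (blinfun_apply s x))\<^sup>2 + (norm x)\<^sup>2 - 4 * ?q s x"
      by (simp add: blinfun.bilinear_simps norm_diff_cinner cinner_simps power_mult_distrib sa[OF s])
    then have "(norm (blinfun_apply (2 *\<^sub>R s - id_blinfun) x))\<^sup>2 \<le> (norm x)\<^sup>2"
      using le[of x] by linarith
    then show "norm (blinfun_apply (2 *\<^sub>R s - id_blinfun) x) \<le> 1 * norm x"
      by (simp add: power2_le_iff_abs_le)
  qed simp
  with e(1) s hes show thesis by (rule that)
qed

text \<open>If all projections are central in \<open>Mp\<close>, then \<open>\<parallel>[h, m] p\<parallel>\<close> is at most half of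
  \<open>\<parallel>[2\<bar>h\<bar> - 1, m] p\<parallel>\<close>, and \<open>2\<bar>h\<bar> - 1\<close> is again a self-adjoint contraction.\<close>

lemma commutator_zero:
  assumes p: "p \<in> M" "\<And>m. m \<in> M \<Longrightarrow> m \<odot> p = p \<odot> m"
    and E: "\<And>e m. projection e \<Longrightarrow> m \<in> M \<Longrightarrow> e \<odot> m \<odot> p = m \<odot> e \<odot> p"
    and m: "m \<in> M" and h: "h \<in> M" "adj h = h" "norm h \<le> 1"
  shows "(h \<odot> m - m \<odot> h) \<odot> p = 0"
proof -
  have "norm ((h \<odot> m - m \<odot> h) \<odot> p) \<le> 2 * norm m * norm p * (1/2) ^ n" for n
    using h
  proof (induction n arbitrary: h)
    case 0
    have "norm (h \<odot> m) \<le> norm m" "norm (m \<odot> h) \<le> norm m"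
      using norm_blinfun_compose[of h m] norm_blinfun_compose[of m h]
        mult_right_mono[OF 0(3), of "norm m"] by (simp_all add: mult.commute)
    then have "norm (h \<odot> m - m \<odot> h) \<le> 2 * norm m"
      using norm_triangle_ineq4[of "h \<odot> m" "m \<odot> h"] by linarith
    then have "norm (h \<odot> m - m \<odot> h) * norm p \<le> 2 * norm m * norm p"
      by (rule mult_right_mono) simp
    then show ?case using norm_blinfun_compose[of "h \<odot> m - m \<odot> h" p] by simp
  next
    case (Suc n)
    obtain e s where es: "projection e" "s \<in> M" "adj s = s" "h = (2 *\<^sub>R e - id_blinfun) \<odot> s"
      "norm (2 *\<^sub>R s - id_blinfun) \<le> 1"
      using absolute_value[OF Suc.prems] by blast
    let ?k = "2 *\<^sub>R s - id_blinfun"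
    \<comment> \<open>Centrality of p moves it next to e, where \<open>E\<close> lets e pass m. The
      reflection 2e - 1 then factors out of the commutator of h with m on p.\<close>
    have "m \<odot> (e \<odot> (s \<odot> p)) = m \<odot> e \<odot> p \<odot> s"
      by (simp add: op_compose_assoc p(2)[OF es(2)])
    also have "\<dots> = e \<odot> (m \<odot> (s \<odot> p))"
      unfolding E[OF es(1) m, symmetric] by (simp add: op_compose_assoc p(2)[OF es(2)])
    finally have "(h \<odot> m - m \<odot> h) \<odot> p = (2 *\<^sub>R e - id_blinfun) \<odot> ((s \<odot> m - m \<odot> s) \<odot> p)"
      by (simp add: es(4) op_ring scaleR_2 algebra_simps)
    moreover have "?k \<odot> m - m \<odot> ?k = 2 *\<^sub>R (s \<odot> m - m \<odot> s)"
      by (simp add: op_ring scaleR_diff_right)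
    ultimately have "(h \<odot> m - m \<odot> h) \<odot> p =
        (1/2) *\<^sub>R ((2 *\<^sub>R e - id_blinfun) \<odot> ((?k \<odot> m - m \<odot> ?k) \<odot> p))"
      by (simp add: op_ring(7,8))
    then have "norm ((h \<odot> m - m \<odot> h) \<odot> p) \<le> norm ((?k \<odot> m - m \<odot> ?k) \<odot> p) / 2"
      using norm_reflection_compose_le[OF es(1), of "(?k \<odot> m - m \<odot> ?k) \<odot> p"] by simp
    also have "\<dots> \<le> (2 * norm m * norm p * (1/2) ^ n) / 2"
      by (intro divide_right_mono Suc.IH) (use es in simp_all)
    finally show ?case by simp
  qed
  moreover have "(\<lambda>n. 2 * norm m * norm p * (1/2) ^ n) \<longlonglongrightarrow> 2 * norm m * norm p * 0"
    by (intro tendsto_mult tendsto_const LIMSEQ_realpow_zero) simp_all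
  ultimately have "norm ((h \<odot> m - m \<odot> h) \<odot> p) \<le> 2 * norm m * norm p * 0"
    by (intro LIMSEQ_le_const[of _ _ "norm ((h \<odot> m - m \<odot> h) \<odot> p)"]) auto
  then show ?thesis by simp
qed

text \<open>The range projection p of C is annihilated as well. The case e = p makes the range of p
  invariant under M, hence p central; general e makes every projection commute with M on p. Then
  \<open>commutator_zero\<close> makes M p abelian, so p = 0.\<close>

lemma no_type_I1_annihilator:
  assumes noI1: "no_type_I1_summand M" and C: "C \<in> M"
    and ann: "\<And>e m. projection e \<Longrightarrow> m \<in> M \<Longrightarrow> (id_blinfun - e) \<odot> m \<odot> e \<odot> C = 0"
  shows "C = 0"
proof -
  obtain p where p: "projection p" "p \<odot> C = C"
    "\<And>X. X \<in> bounded_ops \<Longrightarrow> X \<odot> C = 0 \<Longrightarrow> X \<odot> p = 0"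
    using range_projection[OF C] by blast
  have annp: "(id_blinfun - e) \<odot> m \<odot> e \<odot> p = 0" if "projection e" "m \<in> M" for e m
    by (rule p(3)) (use that in \<open>simp_all add: ann\<close>)
  have pmp: "m \<odot> p = p \<odot> (m \<odot> p)" if "m \<in> M" for m
    using annp[OF p(1) that] p(1) by (simp add: op_ring)
  have central: "m \<odot> p = p \<odot> m" if m: "m \<in> M" for m
  proof -
    have "adj (adj m \<odot> p) = adj (p \<odot> (adj m \<odot> p))" using pmp[of "adj m"] m by simp
    then have "p \<odot> m = p \<odot> (m \<odot> p)" using m p(1) by (simp add: op_compose_assoc)
    then show ?thesis using pmp[OF m] by simp
  qed
  have E: "e \<odot> m \<odot> p = m \<odot> e \<odot> p" if e: "projection e" and m: "m \<in> M" for e m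
  proof -
    have 1: "m \<odot> (e \<odot> p) = e \<odot> (m \<odot> (e \<odot> p))" if "m \<in> M" for m
      using annp[OF e that] by (simp add: op_ring)
    have "adj (adj m \<odot> (e \<odot> p)) = adj (e \<odot> (adj m \<odot> (e \<odot> p)))" using 1[of "adj m"] m by simp
    then have 2: "p \<odot> (e \<odot> m) = p \<odot> (e \<odot> (m \<odot> e))" using m e p(1) by (simp add: op_compose_assoc)
    have "e \<odot> m \<odot> p = p \<odot> (e \<odot> m)" using central[of "e \<odot> m"] e m by simp
    also have "\<dots> = e \<odot> (m \<odot> e) \<odot> p" using central[of "e \<odot> (m \<odot> e)"] e m 2 by simp
    also have "\<dots> = m \<odot> e \<odot> p" using 1[OF m] by (simp add: op_compose_assoc)
    finally show ?thesis .
  qed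
  have sa: "h \<odot> m \<odot> p = m \<odot> h \<odot> p" if h: "h \<in> M" "adj h = h" and m: "m \<in> M" for h m
  proof -
    define r where "r = 1 / (1 + norm h)"
    have r: "r > 0" by (simp add: r_def add_pos_nonneg)
    have "norm (r *\<^sub>R h) \<le> 1" by (simp add: r_def divide_le_eq add_pos_nonneg)
    then have "((r *\<^sub>R h) \<odot> m - m \<odot> (r *\<^sub>R h)) \<odot> p = 0"
      using p(1) central E m h by (intro commutator_zero) simp_all
    then have "r *\<^sub>R (h \<odot> m \<odot> p - m \<odot> h \<odot> p) = 0" by (simp add: op_ring scaleR_diff_right)
    then show ?thesis using r by simp
  qed
  have comm: "A \<odot> m \<odot> p = m \<odot> A \<odot> p" if A: "A \<in> M" and m: "m \<in> M" for A m
  proof -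
    \<comment> \<open>Up to the scalar i this is the skew part of A made self-adjoint; with A + A*
      it recovers 2A.\<close>
    let ?k = "op_scaleC \<i> (A - adj A)"
    have "adj A - A = op_scaleC (- 1) (A - adj A)"
      using op_scaleC_of_real[of "-1" "A - adj A"] by simp
    then have "adj ?k = ?k"
      using A by (simp add: adj_scaleC op_scaleC_op_scaleC)
    then have "op_scaleC (- \<i>) (?k \<odot> m \<odot> p) = op_scaleC (- \<i>) (m \<odot> ?k \<odot> p)"
      using sa[of ?k m] A m by simp
    moreover have "op_scaleC 1 D = D" for D :: "'h \<Rightarrow>\<^sub>L 'h"
      using op_scaleC_of_real[of 1 D] by simp
    ultimately have 1: "(A - adj A) \<odot> m \<odot> p = m \<odot> (A - adj A) \<odot> p"
      using A m by (simp add: op_scaleC_compose_left op_scaleC_compose_right op_scaleC_op_scaleC)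
    have 2: "(A + adj A) \<odot> m \<odot> p = m \<odot> (A + adj A) \<odot> p"
      by (rule sa) (use A m in \<open>simp_all add: add.commute\<close>)
    have "(2 *\<^sub>R A) \<odot> m \<odot> p = m \<odot> (2 *\<^sub>R A) \<odot> p"
      using arg_cong2[OF 1 2, of "(+)"] by (simp add: op_ring scaleR_2 algebra_simps)
    then show ?thesis by (simp add: op_ring)
  qed
  have "central_projection M p"
    using p(1) central by (simp add: central_projection_def)
  moreover have "abelian (summand M p)"
    unfolding abelian_def summand_def
  proof clarify
    fix A B assume A: "A \<in> M" and B: "B \<in> M"
    have "A \<odot> p \<odot> (B \<odot> p) = A \<odot> B \<odot> p" "B \<odot> p \<odot> (A \<odot> p) = B \<odot> A \<odot> p"
      by (simp_all add: op_compose_assoc pmp[OF A, symmetric] pmp[OF B, symmetric])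
    then show "A \<odot> p \<odot> (B \<odot> p) = B \<odot> p \<odot> (A \<odot> p)" using comm[OF A B] by simp
  qed
  ultimately have "p = 0" using noI1 by (auto simp: no_type_I1_summand_def)
  then show ?thesis using p(2) by (simp add: op_ring)
qed

text \<open>With \<open>h = x + x\<^sup>*\<close> and \<open>c = (1 - sqrt (1 - 4h\<^sup>2)) / 2\<close>, the projection has the block form
  with diagonal blocks \<open>e (1 - c)\<close>, \<open>(1 - e) c\<close> and off-diagonal blocks \<open>x\<close>, \<open>x\<^sup>*\<close>.\<close>

lemma projection_with_corner:
  assumes e: "projection e" and x: "x \<in> M" "e \<odot> x = x" "x \<odot> e = 0" "norm x \<le> 1/4"
  obtains F c where "projection F" "c \<in> M" "norm c \<le> 1/2" "c \<odot> e = e \<odot> c"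
    "e \<odot> F \<odot> e = (id_blinfun - c) \<odot> e" "e \<odot> F \<odot> (id_blinfun - e) = x"
proof -
  define y where "y = adj x"
  define h where "h = x + y"
  have y: "y \<in> M" "adj y = x" using x by (simp_all add: y_def)
  have "y \<odot> e = adj (e \<odot> x)" "e \<odot> y = adj (x \<odot> e)" using e x(1) by (simp_all add: y_def)
  then have ye: "y \<odot> e = y" "e \<odot> y = 0" by (simp_all only: x(2,3) y_def adj_zero)
  have xx: "x \<odot> x = 0" using x op_compose_assoc[of x e x] by (simp add: op_ring)
  have yy: "y \<odot> y = 0" using ye op_compose_assoc[of y e y] by (simp add: op_ring)
  have h: "h \<in> M" "adj h = h" using x y by (simp_all add: h_def y_def add.commute)
  \<comment> \<open>The bound 1/4 on x originates here: it makes 4 h^2 a contraction, as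
    \<open>one_minus_sqrt\<close> requires.\<close>
  have "norm h \<le> 1/2"
    using norm_triangle_ineq[of x y] norm_adj_le[of x] x unfolding h_def y_def by simp
  then have "norm h * norm h \<le> 1/2 * (1/2)" by (intro mult_mono) simp_all
  then have "norm (4 *\<^sub>R (h \<odot> h)) \<le> 1" using norm_blinfun_compose[of h h] by simp
  moreover have "4 *\<^sub>R (h \<odot> h) \<in> M" "adj (4 *\<^sub>R (h \<odot> h)) = 4 *\<^sub>R (h \<odot> h)"
    using h by simp_all
  ultimately obtain d where d: "d \<in> M" "adj d = d" "norm d \<le> 1" "2 *\<^sub>R d = d \<odot> d + 4 *\<^sub>R (h \<odot> h)"
    "\<And>a. a \<odot> (4 *\<^sub>R (h \<odot> h)) = (4 *\<^sub>R (h \<odot> h)) \<odot> a \<Longrightarrow> a \<odot> d = d \<odot> a"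
    using one_minus_sqrt by blast
  define c where "c = (1/2) *\<^sub>R d"
  have c: "c \<in> M" "adj c = c" "norm c \<le> 1/2" using d(1-3) by (simp_all add: c_def)
  have hh: "h \<odot> h = x \<odot> y + y \<odot> x" by (simp add: h_def op_ring xx yy)
  have "(1/4) *\<^sub>R (2 *\<^sub>R d) = (1/4) *\<^sub>R (d \<odot> d + 4 *\<^sub>R (h \<odot> h))" by (simp only: d(4))
  then have "(1/2) *\<^sub>R d = (1/4) *\<^sub>R (d \<odot> d) + h \<odot> h" by (simp add: scaleR_add_right)
  moreover have "c \<odot> c = (1/4) *\<^sub>R (d \<odot> d)" by (simp add: c_def op_ring)
  \<comment> \<open>The equation c - c^2 = h^2 is what idempotence of F demands of its diagonal
    blocks.\<close>
  ultimately have "c = c \<odot> c + h \<odot> h" by (simp only: c_def)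
  then have cc: "c \<odot> c = c - x \<odot> y - y \<odot> x" by (simp add: hh algebra_simps)
  \<comment> \<open>The square h^2 is block diagonal, so it commutes with e, and c inherits this; c
    also commutes with h, hence with the corner x = e h.\<close>
  have "e \<odot> d = d \<odot> e"
    by (rule d(5)) (simp add: hh op_ring ye op_compose_left[OF x(2)] op_compose_left[OF ye(2)] x(3))
  then have ce: "c \<odot> e = e \<odot> c" by (simp add: c_def op_ring)
  have "h \<odot> d = d \<odot> h" by (rule d(5)) (simp add: op_ring)
  then have ch: "c \<odot> h = h \<odot> c" by (simp add: c_def op_ring)
  have eh: "e \<odot> h = x" by (simp add: h_def op_ring x ye)
  have "c \<odot> x = e \<odot> (c \<odot> h)" by (simp add: op_compose_left[OF ce[symmetric]] op_compose_assoc eh)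
  also have "\<dots> = x \<odot> c" by (simp add: ch op_compose_left[OF eh])
  finally have cx: "c \<odot> x = x \<odot> c" .
  then have cy: "c \<odot> y = y \<odot> c" using ch by (simp add: h_def op_ring)
  note rules = projection_idem[OF e] x(2,3) ye xx yy ce cx cy cc
  define F where "F = e - e \<odot> c - e \<odot> c + c + x + y"
  have "F \<odot> F = F"
    by (simp add: F_def op_ring rules rules[THEN op_compose_left])
  moreover have "adj F = F" using e x y c by (simp add: F_def ce add.commute add.left_commute) (simp add: y_def)
  moreover have "F \<in> M" using e x y c by (simp add: F_def)
  ultimately have F: "projection F" by (intro projectionI)
  show thesis
  proof (rule that[OF F c(1,3) ce])
    show "e \<odot> F \<odot> e = (id_blinfun - c) \<odot> e" "e \<odot> F \<odot> (id_blinfun - e) = x"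
      by (simp_all add: F_def op_ring rules rules[THEN op_compose_left])
  qed
qed

text \<open>The map B |-> A + c B is a contraction of the complete set M with factor 1/2, and its
  fixed point solves the equation.\<close>

lemma id_minus_invertible:
  assumes c: "c \<in> M" "norm c \<le> 1/2" and A: "A \<in> M"
  obtains B where "B \<in> M" "(id_blinfun - c) \<odot> B = A"
proof -
  have "\<exists>!B\<in>M. A + c \<odot> B = B"
  proof (rule Banach_fix[where c = "1/2"])
    fix B D assume "B \<in> M" "D \<in> M"
    have "norm (c \<odot> (B - D)) \<le> norm c * norm (B - D)" by (rule norm_blinfun_compose)
    also have "\<dots> \<le> 1/2 * norm (B - D)" by (intro mult_right_mono c) simp
    finally show "dist (A + c \<odot> B) (A + c \<odot> D) \<le> 1/2 * dist B D"
      by (simp add: dist_norm op_ring)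
  qed (use A c complete in \<open>auto intro: zero_mem\<close>)
  then obtain B where "B \<in> M" "A + c \<odot> B = B" by blast
  then show thesis by (intro that[of B]) (simp_all add: op_ring algebra_simps)
qed

end

section \<open>Ortho-additive ortho-isomorphisms\<close>

text \<open>Vanishing at 1 means vanishing on the integers, so the bound on [0, 1] extends to all
  reals; but g (n t) = n g t is unbounded in n unless g t = 0.\<close>

lemma additive_bounded_eq_zero:
  fixes g :: "real \<Rightarrow> 'a::real_normed_vector"
  assumes add: "\<And>s t. g (s + t) = g s + g t" and one: "g 1 = 0"
    and bound: "\<And>t. 0 \<le> t \<Longrightarrow> t \<le> 1 \<Longrightarrow> norm (g t) \<le> K"
  shows "g t = 0"
proof -
  have zero: "g 0 = 0" using add[of 0 0] by simp
  have minus: "g (- s) = - g s" for s using add[of s "- s"] zero by (simp add: eq_neg_iff_add_eq_0 add.commute)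
  have mult: "g (real n * s) = real n *\<^sub>R g s" for n s
    by (induction n) (simp_all add: zero add algebra_simps)
  have int: "g (of_int k) = 0" for k
  proof (cases k)
    case (nonneg n)
    then show ?thesis using mult[of n 1] one by simp
  next
    case (neg n)
    then show ?thesis using mult[of "Suc n" 1] one minus[of "real (Suc n)"] by simp
  qed
  have bd: "norm (g s) \<le> K" for s
  proof -
    have "g s = g (frac s) + g (of_int \<lfloor>s\<rfloor>)" by (simp add: frac_def flip: add)
    then show ?thesis using bound[of "frac s"] by (simp add: int frac_ge_0 frac_lt_1 less_imp_le)
  qed
  have "norm (g t) = 0"
  proof (rule real_archimedian_rdiv_eq_0)
    fix m :: nat
    show "real m * norm (g t) \<le> K" using bd[of "real m * t"] by (simp add: mult)
  qed simp
  then show ?thesis by simp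
qed

section \<open>Multipliers of \<phi>\<close>

locale ortho_additive_iso = M: vn_algebra M + N: vn_algebra N
  for M :: "('h::chilbert_space \<Rightarrow>\<^sub>L 'h) set"
    and N :: "('k::chilbert_space \<Rightarrow>\<^sub>L 'k) set" +
  fixes \<phi> :: "('h \<Rightarrow>\<^sub>L 'h) \<Rightarrow> ('k \<Rightarrow>\<^sub>L 'k)"
  assumes no_type_I1: "no_type_I1_summand M"
    and ortho_additive: "ortho_additive M \<phi>"
    and ortho_isomorphism: "ortho_isomorphism M N \<phi>"
begin

lemma phi_bij: "bij_betw \<phi> M N"
  using ortho_isomorphism by (simp add: ortho_isomorphism_def)

lemma phi_mem [simp]: "A \<in> M \<Longrightarrow> \<phi> A \<in> N"
  using phi_bij by (rule bij_betwE[rule_format])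

lemma phi_eq_iff: "A \<in> M \<Longrightarrow> B \<in> M \<Longrightarrow> \<phi> A = \<phi> B \<longleftrightarrow> A = B"
  using phi_bij by (auto simp: bij_betw_def inj_on_def)

lemma phi_surj:
  assumes "Y \<in> N"
  obtains A where "A \<in> M" "\<phi> A = Y"
  using phi_bij assms by (auto simp: bij_betw_def)

lemma phi_orthogonal_iff: "A \<in> M \<Longrightarrow> B \<in> M \<Longrightarrow> adj (\<phi> A) \<odot> \<phi> B = 0 \<longleftrightarrow> adj A \<odot> B = 0"
  using ortho_isomorphism by (auto simp: ortho_isomorphism_def op_orthogonal_def)

lemma phi_add_orthogonal: "A \<in> M \<Longrightarrow> B \<in> M \<Longrightarrow> adj A \<odot> B = 0 \<Longrightarrow> \<phi> (A + B) = \<phi> A + \<phi> B"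
  using ortho_additive by (auto simp: ortho_additive_def op_orthogonal_def)

lemma phi_zero [simp]: "\<phi> 0 = 0"
  using phi_add_orthogonal[of 0 0] by (simp add: op_ring)

lemma phi_eq_zero_iff: "A \<in> M \<Longrightarrow> \<phi> A = 0 \<longleftrightarrow> A = 0"
  using phi_eq_iff[of A 0] by simp

definition "unit_preimage = inv_into M \<phi> id_blinfun"

lemma unit_preimage [simp]: "unit_preimage \<in> M" "\<phi> unit_preimage = id_blinfun"
  using bij_betw_imp_surj_on[OF phi_bij] N.id_mem
  by (auto simp: unit_preimage_def inv_into_into f_inv_into_f)

text \<open>The only possible multiplier: if \<phi>(m A) = Y \<phi>(A) for all A, then taking the A
  with \<phi>(A) = 1 forces this value of Y. It is defined for every m before the identity is
  known.\<close>

definition "\<rho> m = \<phi> (m \<odot> unit_preimage)"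

lemma rho_mem [simp]: "m \<in> M \<Longrightarrow> \<rho> m \<in> N"
  by (simp add: \<rho>_def)

definition "multiplier m \<longleftrightarrow> m \<in> M \<and> (\<forall>A\<in>M. \<phi> (m \<odot> A) = \<rho> m \<odot> \<phi> A)"

lemma multiplierI:
  assumes "m \<in> M" and "\<And>A. A \<in> M \<Longrightarrow> \<phi> (m \<odot> A) = Y \<odot> \<phi> A"
  shows "multiplier m" "\<rho> m = Y"
  using assms by (auto simp: multiplier_def \<rho>_def op_id)

lemma multiplier_mem: "multiplier m \<Longrightarrow> m \<in> M"
  and multiplier_phi: "multiplier m \<Longrightarrow> A \<in> M \<Longrightarrow> \<phi> (m \<odot> A) = \<rho> m \<odot> \<phi> A"
  by (auto simp: multiplier_def)

text \<open>The range projection \<open>q\<close> of \<open>\<phi> p\<close> implements \<open>\<phi> (p A) = q (\<phi> A)\<close>: it kills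
  \<open>\<phi> ((1 - p) A)\<close>, and \<open>D = (1 - q) (\<phi> (p A))\<close> vanishes because its preimage is orthogonal to \<open>p\<close>,
  hence to \<open>p A\<close>, so that \<open>D\<^sup>* D = D\<^sup>* (\<phi> (p A)) = 0\<close>.\<close>

lemma projection_multiplier:
  assumes p: "M.projection p"
  shows "multiplier p" "N.projection (\<rho> p)"
proof -
  have pM: "p \<in> M" using p by simp
  obtain q where q: "N.projection q" "q \<odot> \<phi> p = \<phi> p"
    "\<And>X. X \<in> bounded_ops \<Longrightarrow> X \<odot> \<phi> p = 0 \<Longrightarrow> X \<odot> q = 0"
    using N.range_projection[OF phi_mem[OF pM]] by blast
  have phip: "adj (\<phi> p) \<odot> q = adj (\<phi> p)"
  proof -
    have "adj (\<phi> p) \<odot> q = adj (q \<odot> \<phi> p)" using q(1) pM by simp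
    then show ?thesis by (simp only: q(2))
  qed
  have "\<phi> (p \<odot> A) = q \<odot> \<phi> A" if A: "A \<in> M" for A
  proof -
    have "\<phi> (p \<odot> A + (id_blinfun - p) \<odot> A) = \<phi> (p \<odot> A) + \<phi> ((id_blinfun - p) \<odot> A)"
      by (rule phi_add_orthogonal) (use p A in \<open>simp_all add: op_ring\<close>)
    then have split: "\<phi> A = \<phi> (p \<odot> A) + \<phi> ((id_blinfun - p) \<odot> A)" by (simp add: op_ring)
    have "adj (\<phi> ((id_blinfun - p) \<odot> A)) \<odot> \<phi> p = 0"
      by (subst phi_orthogonal_iff) (use p A in \<open>simp_all add: op_ring\<close>)
    then have "adj (\<phi> ((id_blinfun - p) \<odot> A)) \<odot> q = 0"
      using p A by (intro q(3)) simp_all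
    then have "adj (adj (\<phi> ((id_blinfun - p) \<odot> A)) \<odot> q) = 0" by simp
    then have 2: "q \<odot> \<phi> ((id_blinfun - p) \<odot> A) = 0" using q(1) p A by simp
    define D where "D = (id_blinfun - q) \<odot> \<phi> (p \<odot> A)"
    have D: "D \<in> N" using q(1) p A by (simp add: D_def)
    obtain C where C: "C \<in> M" "\<phi> C = D" using phi_surj[OF D] by blast
    have "adj (\<phi> p) \<odot> \<phi> C = 0"
      unfolding C(2) by (simp add: D_def op_ring op_compose_left[OF phip])
    then have "p \<odot> C = 0" using phi_orthogonal_iff[OF pM C(1)] p by simp
    then have "adj (p \<odot> C) = 0" by simp
    then have "adj C \<odot> p = 0" using p C(1) by simp
    then have "adj (\<phi> C) \<odot> \<phi> (p \<odot> A) = 0"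
      using p A C(1) by (subst phi_orthogonal_iff) (simp_all add: op_ring op_compose_left)
    moreover have "adj D \<odot> D = adj D \<odot> \<phi> (p \<odot> A)"
      using q(1) p A by (simp add: D_def op_ring)
    ultimately have "adj D \<odot> D = 0" by (simp only: C(2))
    then have "D = 0" by (rule adj_compose_self_eq_zero[OF N.bounded_ops[OF D]])
    then have "q \<odot> \<phi> (p \<odot> A) = \<phi> (p \<odot> A)" by (simp add: D_def op_ring)
    then show ?thesis unfolding split by (simp only: op_ring(2) 2) simp
  qed
  note mult = multiplierI[OF pM this]
  show "multiplier p" by (rule mult)
  show "N.projection (\<rho> p)" using q(1) by (simp only: mult)
qed

lemma multiplier_compose:
  assumes m: "multiplier m" and n: "multiplier n"
  shows "multiplier (m \<odot> n)" "\<rho> (m \<odot> n) = \<rho> m \<odot> \<rho> n"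
proof -
  have "\<phi> (m \<odot> n \<odot> A) = \<rho> m \<odot> \<rho> n \<odot> \<phi> A" if "A \<in> M" for A
    using that m n multiplier_mem[OF n] by (simp add: op_compose_assoc multiplier_phi)
  then show "multiplier (m \<odot> n)" "\<rho> (m \<odot> n) = \<rho> m \<odot> \<rho> n"
    using multiplier_mem[OF m] multiplier_mem[OF n] by (auto intro!: multiplierI)
qed

text \<open>\<phi> itself need not preserve adjoints. Preservation by \<rho> starts at projections,
  whose images are self-adjoint, and is carried through products and sums.\<close>

definition "star_multiplier m \<longleftrightarrow> multiplier m \<and> multiplier (adj m) \<and> \<rho> (adj m) = adj (\<rho> m)"

lemma star_multiplier_compose:
  assumes m: "star_multiplier m" and n: "star_multiplier n"
  shows "star_multiplier (m \<odot> n)"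
proof -
  have "m \<in> M" "n \<in> M" using m n by (auto simp: star_multiplier_def multiplier_mem)
  then show ?thesis using m n by (simp add: star_multiplier_def multiplier_compose)
qed

lemma projection_star_multiplier: "M.projection p \<Longrightarrow> star_multiplier p"
  using projection_multiplier by (simp add: star_multiplier_def)

text \<open>The idea is to compute \<open>\<phi> (e F (e A + (1 - e) B))\<close> in two ways, with a projection \<open>F\<close>
  whose corner \<open>e F (1 - e)\<close> is \<open>x\<close> and whose corner \<open>e F e\<close> is invertible.\<close>

lemma small_corner:
  assumes e: "M.projection e" and x: "x \<in> M" "e \<odot> x = x" "x \<odot> e = 0" "norm x \<le> 1/4"
  shows "star_multiplier x"
    and "A \<in> M \<Longrightarrow> e \<odot> A = A \<Longrightarrow> B \<in> M \<Longrightarrow> \<phi> (A + x \<odot> B) = \<phi> A + \<phi> (x \<odot> B)"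
proof -
  obtain F c where F: "M.projection F" and c: "c \<in> M" "norm c \<le> 1/2" "c \<odot> e = e \<odot> c"
    and eFe: "e \<odot> F \<odot> e = (id_blinfun - c) \<odot> e" and eFf: "e \<odot> F \<odot> (id_blinfun - e) = x"
    using M.projection_with_corner[OF e x] by blast
  have f: "M.projection (id_blinfun - e)" using e by (rule M.projection_compl)
  have "star_multiplier (e \<odot> F \<odot> (id_blinfun - e))"
    by (intro star_multiplier_compose projection_star_multiplier e F f)
  then show "star_multiplier x" by (simp only: eFf)
  assume A: "A \<in> M" "e \<odot> A = A" and B: "B \<in> M"
  obtain A1 where A1: "A1 \<in> M" "(id_blinfun - c) \<odot> A1 = A"
    using M.id_minus_invertible[OF c(1,2) A(1)] by blast
  have mult: "multiplier (e \<odot> F)"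
    using e F by (intro multiplier_compose projection_multiplier)
  \<comment> \<open>X and Z have orthogonal ranges, so \<phi> is additive on them. Left
    multiplication by e F turns this pair into A and x B, which need not be orthogonal.\<close>
  define X Z where "X = e \<odot> A1" and "Z = (id_blinfun - e) \<odot> B"
  have XZ: "X \<in> M" "Z \<in> M" using e A1 B by (simp_all add: X_def Z_def)
  have "\<phi> (X + Z) = \<phi> X + \<phi> Z"
    by (rule phi_add_orthogonal) (use e A1 B in \<open>simp_all add: X_def Z_def op_ring\<close>)
  then have "\<phi> (e \<odot> F \<odot> (X + Z)) = \<phi> (e \<odot> F \<odot> X) + \<phi> (e \<odot> F \<odot> Z)"
    by (simp only: multiplier_phi[OF mult XZ(1)] multiplier_phi[OF mult XZ(2)]
        multiplier_phi[OF mult M.add_mem[OF XZ]] op_ring(2)[of "\<rho> (e \<odot> F)"])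
  moreover have "e \<odot> F \<odot> X = A"
  proof -
    have "e \<odot> F \<odot> X = (id_blinfun - c) \<odot> e \<odot> A1" by (simp only: X_def eFe flip: op_compose_assoc)
    also have "\<dots> = e \<odot> ((id_blinfun - c) \<odot> A1)" by (simp add: op_ring op_compose_left[OF c(3)])
    finally show ?thesis by (simp add: A1 A)
  qed
  moreover have "e \<odot> F \<odot> Z = x \<odot> B"
    by (simp only: Z_def eFf flip: op_compose_assoc)
  moreover have "e \<odot> F \<odot> (X + Z) = e \<odot> F \<odot> X + e \<odot> F \<odot> Z"
    by (rule op_ring)
  ultimately show "\<phi> (A + x \<odot> B) = \<phi> A + \<phi> (x \<odot> B)" by (simp only:)
qed

section \<open>Corners and the additivity of \<phi>\<close>

definition "corner e x \<longleftrightarrow> M.projection e \<and> x \<in> M \<and> e \<odot> x = x \<and> x \<odot> e = 0"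

lemma corner_scaleR: "corner e x \<Longrightarrow> corner e (r *\<^sub>R x)"
  by (simp add: corner_def op_ring)

lemma corner_mem: "corner e x \<Longrightarrow> x \<in> M"
  by (simp add: corner_def)

lemma corner_annihilator:
  assumes C: "C \<in> M" and ann: "\<And>e x. corner e x \<Longrightarrow> norm x \<le> 1/4 \<Longrightarrow> x \<odot> C = 0"
  shows "C = 0"
proof (rule M.no_type_I1_annihilator[OF no_type_I1 C])
  fix e m assume e: "M.projection e" and m: "m \<in> M"
  define x where "x = (id_blinfun - e) \<odot> m \<odot> e"
  \<comment> \<open>Scales x into the ball of radius 1/4 in which corners are assumed to annihilate
    C.\<close>
  define r where "r = 1 / (4 * (1 + norm x))"
  have "r > 0" by (simp add: r_def add_pos_nonneg)
  have "corner (id_blinfun - e) x"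
    using e m M.projection_compl[OF e] by (simp add: corner_def x_def op_ring)
  then have "r *\<^sub>R x \<odot> C = 0"
    by (intro ann[of "id_blinfun - e"] corner_scaleR) (simp_all add: r_def divide_le_eq add_pos_nonneg)
  then have "x \<odot> C = 0" using \<open>r > 0\<close> by (simp add: op_ring)
  then show "(id_blinfun - e) \<odot> m \<odot> e \<odot> C = 0" by (simp only: x_def)
qed

text \<open>Surjectivity writes the additivity defect as \<phi>(C), so that corners can be cancelled
  in M, where the type I_1 hypothesis holds. For a small corner x the element x A is absorbed by e,
  as \<open>small_corner\<close> requires.\<close>

lemma phi_add:
  assumes A: "A \<in> M" and B: "B \<in> M"
  shows "\<phi> (A + B) = \<phi> A + \<phi> B"
proof -
  have "\<phi> (A + B) - \<phi> A - \<phi> B \<in> N" using A B by simp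
  then obtain C where C: "C \<in> M" "\<phi> C = \<phi> (A + B) - \<phi> A - \<phi> B" by (rule phi_surj)
  have "C = 0"
  proof (rule corner_annihilator[OF C(1)])
    fix e x assume "corner e x" and small: "norm x \<le> 1/4"
    then have e: "M.projection e" and x: "x \<in> M" "e \<odot> x = x" "x \<odot> e = 0"
      by (auto simp: corner_def)
    have mult: "multiplier x" using small_corner(1)[OF e x small] by (simp add: star_multiplier_def)
    have "\<phi> (x \<odot> A + x \<odot> B) = \<phi> (x \<odot> A) + \<phi> (x \<odot> B)"
      by (rule small_corner(2)[OF e x small]) (use A B x in \<open>simp_all add: op_compose_left\<close>)
    then have "\<phi> (x \<odot> (A + B)) = \<phi> (x \<odot> A) + \<phi> (x \<odot> B)" by (simp add: op_ring)
    then have "\<rho> x \<odot> \<phi> (A + B) = \<rho> x \<odot> \<phi> A + \<rho> x \<odot> \<phi> B"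
      using A B by (simp add: multiplier_phi[OF mult])
    then have "\<phi> (x \<odot> C) = 0" using C by (simp add: multiplier_phi[OF mult] op_ring)
    then show "x \<odot> C = 0" using x C by (simp add: phi_eq_zero_iff)
  qed
  then show ?thesis using C(2) by (simp add: algebra_simps)
qed

section \<open>The ideal of multipliers generated by corners\<close>

lemma rho_add: "m \<in> M \<Longrightarrow> n \<in> M \<Longrightarrow> \<rho> (m + n) = \<rho> m + \<rho> n"
  by (simp add: \<rho>_def op_ring phi_add)

lemma star_multiplier_add:
  assumes "star_multiplier m" "star_multiplier n"
  shows "star_multiplier (m + n)"
proof -
  have mem: "m \<in> M" "n \<in> M" using assms by (auto simp: star_multiplier_def multiplier_mem)
  have "multiplier (m + n)" if "multiplier m" "multiplier n" for m n
    using that by (simp add: multiplier_def op_ring phi_add rho_add)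
  then show ?thesis using assms mem by (simp add: star_multiplier_def rho_add)
qed

text \<open>Additivity removes the norm bound by repeated halving; real homogeneity of \<rho> is not
  yet available.\<close>

lemma corner_star_multiplier:
  assumes "corner e x"
  shows "star_multiplier x"
proof -
  have "star_multiplier x" if "corner e x" "norm x \<le> 2 ^ n / 4" for n x
    using that
  proof (induction n arbitrary: x)
    case 0
    then show ?case using small_corner(1)[of e x] by (simp add: corner_def)
  next
    case (Suc n)
    have "star_multiplier ((1/2) *\<^sub>R x + (1/2) *\<^sub>R x)"
      using Suc.prems by (intro star_multiplier_add Suc.IH corner_scaleR) simp_all
    then show ?case by (simp flip: scaleR_add_left)
  qed
  moreover obtain n where "4 * norm x < 2 ^ n"
    using real_arch_pow[of 2 "4 * norm x"] by auto
  ultimately show ?thesis using assms by (metis less_imp_le mult.commute pos_le_divide_eq zero_less_numeral)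
qed

text \<open>Since x = x (1 - e), the product splits as x m = x m (1 - e) + x ((1 - e) m e): a corner
  for e plus a product of a corner for e with one for 1 - e.\<close>

lemma corner_compose_star_multiplier:
  assumes x: "corner e x" and m: "m \<in> M"
  shows "star_multiplier (x \<odot> m)"
proof -
  have e: "M.projection e" "x \<in> M" "e \<odot> x = x" "x \<odot> e = 0" using x by (auto simp: corner_def)
  have f: "M.projection (id_blinfun - e)" using e(1) by (rule M.projection_compl)
  have "corner e (x \<odot> m \<odot> (id_blinfun - e))"
    using e m by (simp add: corner_def op_ring op_compose_left[OF e(3)])
  moreover have "corner (id_blinfun - e) ((id_blinfun - e) \<odot> m \<odot> e)"
    using e m f by (simp add: corner_def op_ring)
  ultimately have "star_multiplier (x \<odot> m \<odot> (id_blinfun - e) + x \<odot> ((id_blinfun - e) \<odot> m \<odot> e))"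
    using x by (intro star_multiplier_add star_multiplier_compose corner_star_multiplier)
  also have "x \<odot> m \<odot> (id_blinfun - e) + x \<odot> ((id_blinfun - e) \<odot> m \<odot> e) = x \<odot> m"
    by (simp add: op_ring op_compose_left[OF e(4)])
  finally show ?thesis .
qed

text \<open>\<open>corner_annihilator\<close> carried to N along \<phi>: the images of the corners
  detect zero there too.\<close>

lemma corner_cancel:
  assumes "Y \<in> N" "\<And>e x. corner e x \<Longrightarrow> \<rho> x \<odot> Y = 0"
  shows "Y = 0"
proof -
  obtain C where C: "C \<in> M" "\<phi> C = Y" using assms(1) by (rule phi_surj)
  have "C = 0"
  proof (rule corner_annihilator[OF C(1)])
    fix e x assume x: "corner e x"
    then have "multiplier x" using corner_star_multiplier by (simp add: star_multiplier_def)
    then have "\<phi> (x \<odot> C) = 0" using assms(2)[OF x] C by (simp add: multiplier_phi)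
    then show "x \<odot> C = 0" using corner_mem[OF x] C(1) by (simp add: phi_eq_zero_iff)
  qed
  then show ?thesis using C(2) by simp
qed

text \<open>The corners generate an ideal of multipliers with zero annihilator, so the multiplier
  property and \<open>*\<close>-preservation pass from that ideal to all of \<open>M\<close>.\<close>

lemma multiplier_all:
  assumes m: "m \<in> M"
  shows "multiplier m"
  unfolding multiplier_def
proof (intro conjI ballI m)
  fix A assume A: "A \<in> M"
  have "\<phi> (m \<odot> A) - \<rho> m \<odot> \<phi> A = 0"
  proof (rule corner_cancel)
    show "\<phi> (m \<odot> A) - \<rho> m \<odot> \<phi> A \<in> N" using m A by simp
    fix e x assume x: "corner e x"
    have mult: "multiplier x" "multiplier (x \<odot> m)"
      using corner_star_multiplier[OF x] corner_compose_star_multiplier[OF x m]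
      by (simp_all add: star_multiplier_def)
    \<comment> \<open>Two readings of \<phi>(x m A), with x and with x m as the multiplier. Putting
      \<open>unit_preimage\<close> for A gives the companion identity for \<rho>.\<close>
    have "\<rho> x \<odot> \<phi> (m \<odot> A) = \<rho> (x \<odot> m) \<odot> \<phi> A"
      using m A multiplier_phi[OF mult(1), of "m \<odot> A"] multiplier_phi[OF mult(2) A]
      by (simp add: op_compose_assoc)
    moreover have "\<rho> x \<odot> \<rho> m = \<rho> (x \<odot> m)"
      using m multiplier_phi[OF mult(1), of "m \<odot> unit_preimage"] by (simp add: \<rho>_def op_compose_assoc)
    ultimately show "\<rho> x \<odot> (\<phi> (m \<odot> A) - \<rho> m \<odot> \<phi> A) = 0"
      by (simp add: op_ring op_compose_left)
  qed
  then show "\<phi> (m \<odot> A) = \<rho> m \<odot> \<phi> A" by simp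
qed

lemma phi_compose: "m \<in> M \<Longrightarrow> A \<in> M \<Longrightarrow> \<phi> (m \<odot> A) = \<rho> m \<odot> \<phi> A"
  by (simp add: multiplier_phi multiplier_all)

lemma rho_compose: "m \<in> M \<Longrightarrow> n \<in> M \<Longrightarrow> \<rho> (m \<odot> n) = \<rho> m \<odot> \<rho> n"
  by (simp add: multiplier_compose multiplier_all)

lemma rho_adj:
  assumes m: "m \<in> M"
  shows "\<rho> (adj m) = adj (\<rho> m)"
proof -
  define D where "D = \<rho> (adj m) - adj (\<rho> m)"
  have D: "D \<in> N" using m by (simp add: D_def)
  have "adj D = 0"
  proof (rule corner_cancel)
    show "adj D \<in> N" using D by simp
    fix e x assume x: "corner e x"
    have xM: "x \<in> M" using x by (rule corner_mem)
    have "\<rho> (adj m) \<odot> \<rho> (adj x) = \<rho> (adj (x \<odot> m))"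
      using m xM by (simp add: rho_compose)
    also have "\<dots> = adj (\<rho> (x \<odot> m))"
      using corner_compose_star_multiplier[OF x m] by (simp add: star_multiplier_def)
    also have "\<dots> = adj (\<rho> m) \<odot> adj (\<rho> x)" using m xM by (simp add: rho_compose)
    finally have "D \<odot> adj (\<rho> x) = 0"
      using corner_star_multiplier[OF x] by (simp add: D_def op_ring star_multiplier_def)
    then have "adj (D \<odot> adj (\<rho> x)) = 0" by simp
    then show "\<rho> x \<odot> adj D = 0" using D xM by simp
  qed
  then have "adj (adj D) = 0" by simp
  then show ?thesis using D by (simp add: D_def)
qed

section \<open>The multiplier map as a real-linear *-ring isomorphism\<close>

lemma rho_id: "\<rho> id_blinfun = id_blinfun"
  by (simp add: \<rho>_def op_ring)

lemma rho_zero: "\<rho> 0 = 0"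
  by (simp add: \<rho>_def op_ring)

lemma phi_eq_rho: "A \<in> M \<Longrightarrow> \<phi> A = \<rho> A \<odot> \<phi> id_blinfun"
  using phi_compose[of A id_blinfun] by (simp add: op_ring)

lemma rho_bij: "bij_betw \<rho> M N"
  unfolding bij_betw_def
proof
  show "inj_on \<rho> M"
    by (rule inj_onI) (metis phi_eq_iff phi_eq_rho)
  show "\<rho> ` M = N"
  proof (intro equalityI subsetI)
    fix Y assume Y: "Y \<in> N"
    then have "Y \<odot> \<phi> id_blinfun \<in> N" by simp
    \<comment> \<open>The identity \<phi>(m) = \<rho>(m) \<phi>(1) singles out this m as the only
      candidate.\<close>
    then obtain m where m: "m \<in> M" "\<phi> m = Y \<odot> \<phi> id_blinfun" by (rule phi_surj)
    define Z where "Z = Y - \<rho> m"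
    have Z: "Z \<in> N" using Y m by (simp add: Z_def)
    \<comment> \<open>Right cancellation of \<phi>(1): Z* is orthogonal to it, so the preimage of Z*
      is orthogonal to 1 and vanishes.\<close>
    have "Z \<odot> \<phi> id_blinfun = 0" using phi_eq_rho[OF m(1)] m(2) by (simp add: Z_def op_ring)
    then have "adj (Z \<odot> \<phi> id_blinfun) = 0" by simp
    then have *: "adj (\<phi> id_blinfun) \<odot> adj Z = 0" using Z by simp
    obtain C where C: "C \<in> M" "\<phi> C = adj Z" using Z phi_surj[of "adj Z"] by auto
    have "C = 0" using * phi_orthogonal_iff[of id_blinfun C] C by (simp add: op_ring)
    then have "adj (adj Z) = 0" using C(2) by simp
    then show "Y \<in> \<rho> ` M" using Z m(1) by (auto simp: Z_def)
  qed auto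
qed

lemma rho_eq_iff: "A \<in> M \<Longrightarrow> B \<in> M \<Longrightarrow> \<rho> A = \<rho> B \<longleftrightarrow> A = B"
  using rho_bij by (auto simp: bij_betw_def inj_on_def)

lemma rho_surj:
  assumes "Y \<in> N"
  obtains A where "A \<in> M" "\<rho> A = Y"
  using rho_bij assms by (auto simp: bij_betw_def)

lemma rho_minus: "A \<in> M \<Longrightarrow> \<rho> (- A) = - \<rho> A"
  using rho_add[of A "- A"] by (simp add: rho_zero eq_neg_iff_add_eq_0 add.commute)

lemma rho_diff: "A \<in> M \<Longrightarrow> B \<in> M \<Longrightarrow> \<rho> (A - B) = \<rho> A - \<rho> B"
  using rho_add[of A "- B"] by (simp add: rho_minus)

text \<open>A ring homomorphism need not be real-linear, but a \<open>*\<close>-preserving one is bounded on real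
  scalars: \<open>\<rho> (u)\<^sup>2 + \<rho> (w)\<^sup>2 = 1\<close> whenever \<open>u\<^sup>2 + w\<^sup>2 = 1\<close>.\<close>

lemma rho_scaleR:
  assumes A: "A \<in> M"
  shows "\<rho> (r *\<^sub>R A) = r *\<^sub>R \<rho> A"
proof -
  let ?f = "\<lambda>t::real. \<rho> (t *\<^sub>R id_blinfun)"
  have fadd: "?f (s + t) = ?f s + ?f t" for s t by (simp add: scaleR_add_left rho_add)
  have fmult: "?f (s * t) = ?f s \<odot> ?f t" for s t
    using rho_compose[of "s *\<^sub>R id_blinfun" "t *\<^sub>R id_blinfun"] by (simp add: op_ring mult.commute)
  have fadj: "adj (?f t) = ?f t" for t using rho_adj[of "t *\<^sub>R id_blinfun"] by simp
  have sq: "(norm (blinfun_apply (?f t) x))\<^sup>2 = Re (cinner x (blinfun_apply (?f (t * t)) x))" for t x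
  proof -
    have "(norm (blinfun_apply (?f t) x))\<^sup>2 = Re (cinner (blinfun_apply (?f t) x) (blinfun_apply (?f t) x))"
      by (simp only: Re_cinner_self)
    also have "cinner (blinfun_apply (?f t) x) (blinfun_apply (?f t) x) =
        cinner x (blinfun_apply (adj (?f t)) (blinfun_apply (?f t) x))"
      by (rule cinner_adj_right) simp
    finally show ?thesis by (simp add: fadj fmult)
  qed
  have "norm (?f u) \<le> 1" if u: "0 \<le> u" "u \<le> 1" for u
  proof (rule norm_blinfun_bound)
    fix x
    define w where "w = sqrt (1 - u * u)"
    have "u * u \<le> 1" using u by (simp add: mult_le_one)
    then have "u * u + w * w = 1" by (simp add: w_def)
    then have "?f (u * u) + ?f (w * w) = id_blinfun" using fadd[of "u * u" "w * w"] rho_id by simp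
    then have "Re (cinner x (blinfun_apply (?f (u * u) + ?f (w * w)) x)) = (norm x)\<^sup>2"
      by (simp add: Re_cinner_self)
    then have "(norm (blinfun_apply (?f u) x))\<^sup>2 + (norm (blinfun_apply (?f w) x))\<^sup>2 = (norm x)\<^sup>2"
      by (simp add: blinfun.bilinear_simps cinner_simps sq)
    then have "(norm (blinfun_apply (?f u) x))\<^sup>2 \<le> (norm x)\<^sup>2"
      using zero_le_power2[of "norm (blinfun_apply (?f w) x)"] by linarith
    then show "norm (blinfun_apply (?f u) x) \<le> 1 * norm x" by (simp add: power2_le_iff_abs_le)
  qed simp
  note bound = this
  have "?f r - r *\<^sub>R id_blinfun = 0"
  proof (rule additive_bounded_eq_zero[where K = 2])
    show "?f (s + t) - (s + t) *\<^sub>R id_blinfun = (?f s - s *\<^sub>R id_blinfun) + (?f t - t *\<^sub>R id_blinfun)"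
      for s t unfolding fadd by (simp add: algebra_simps)
    show "?f 1 - 1 *\<^sub>R id_blinfun = 0" by (simp add: rho_id)
    fix t :: real assume t: "0 \<le> t" "t \<le> 1"
    have "norm (t *\<^sub>R (id_blinfun :: 'k \<Rightarrow>\<^sub>L 'k)) \<le> 1 * 1"
      unfolding norm_scaleR using t by (intro mult_mono norm_blinfun_id_le) simp_all
    then show "norm (?f t - t *\<^sub>R id_blinfun) \<le> 2"
      using norm_triangle_ineq4[of "?f t" "t *\<^sub>R id_blinfun"] bound[OF t] by linarith
  qed
  then have "?f r = r *\<^sub>R id_blinfun" by simp
  then show ?thesis
    using rho_compose[of "r *\<^sub>R id_blinfun" A] A by (simp add: op_ring)
qed

section \<open>Splitting into linear and conjugate-linear summands\<close>

lemma rho_summand_bij: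
  assumes P: "P \<in> M"
  shows "bij_betw \<rho> (summand M P) (summand N (\<rho> P))"
  unfolding bij_betw_def
proof
  show "inj_on \<rho> (summand M P)"
    using P by (auto simp: inj_on_def summand_def rho_eq_iff)
  show "\<rho> ` summand M P = summand N (\<rho> P)"
  proof (intro equalityI subsetI)
    fix Y assume "Y \<in> summand N (\<rho> P)"
    then obtain B where B: "B \<in> N" "Y = B \<odot> \<rho> P" by (auto simp: summand_def)
    obtain A where "A \<in> M" "\<rho> A = B" using rho_surj[OF B(1)] by blast
    then have "\<rho> (A \<odot> P) = Y" "A \<odot> P \<in> summand M P"
      using P B by (auto simp: rho_compose summand_def)
    then show "Y \<in> \<rho> ` summand M P" by blast
  next
    fix Y assume "Y \<in> \<rho> ` summand M P"
    then show "Y \<in> summand N (\<rho> P)" using P by (auto simp: rho_compose summand_def)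
  qed
qed

text \<open>Since \<open>\<rho> (\<i>)\<close> is a central square root of \<open>-1\<close>, it is \<open>\<i>\<close> on a central summand \<open>Q\<close> and
  \<open>- \<i>\<close> on its complement.\<close>

lemma rho_direct_sum: "direct_sum_star_conj_star M N \<rho>"
proof -
  define I where "I = op_scaleC \<i> (id_blinfun :: 'h \<Rightarrow>\<^sub>L 'h)"
  define J where "J = op_scaleC \<i> (id_blinfun :: 'k \<Rightarrow>\<^sub>L 'k)"
  define \<iota> where "\<iota> = \<rho> I"
  have minus1: "op_scaleC (- 1) A = - A" for A :: "'z::chilbert_space \<Rightarrow>\<^sub>L 'z"
    using op_scaleC_of_real[of "-1" A] by simp
  have I: "I \<in> M" by (simp add: I_def)
  have J: "J \<in> N" by (simp add: J_def)
  have \<iota>: "\<iota> \<in> N" using I by (simp add: \<iota>_def)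
  have II: "I \<odot> I = - id_blinfun"
    by (simp add: I_def op_scaleC_compose_left op_id op_scaleC_op_scaleC minus1)
  have JJ: "J \<odot> J = - id_blinfun"
    by (simp add: J_def op_scaleC_compose_left op_id op_scaleC_op_scaleC minus1)
  have adjI: "adj I = - I"
    using minus1[of I] by (simp add: I_def adj_scaleC[OF M.bounded_ops] op_scaleC_op_scaleC)
  have adjJ: "adj J = - J"
    using minus1[of J] by (simp add: J_def adj_scaleC[OF N.bounded_ops] op_scaleC_op_scaleC)
  have IA: "I \<odot> A = op_scaleC \<i> A" "A \<odot> I = op_scaleC \<i> A" if "A \<in> M" for A
    using that by (simp_all add: I_def op_scaleC_compose_left op_scaleC_compose_right op_id)
  have JA: "J \<odot> A = op_scaleC \<i> A" "A \<odot> J = op_scaleC \<i> A" if "A \<in> N" for A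
    using that by (simp_all add: J_def op_scaleC_compose_left op_scaleC_compose_right op_id)
  have \<iota>\<iota>: "\<iota> \<odot> \<iota> = - id_blinfun"
    using I by (simp add: \<iota>_def II rho_minus rho_id flip: rho_compose)
  have adj\<iota>: "adj \<iota> = - \<iota>"
    using I by (simp add: \<iota>_def adjI rho_minus flip: rho_adj)
  have \<iota>c: "B \<odot> \<iota> = \<iota> \<odot> B" if "B \<in> N" for B
  proof -
    obtain A where "A \<in> M" "\<rho> A = B" using rho_surj[OF \<open>B \<in> N\<close>] by blast
    then show ?thesis using I by (auto simp: \<iota>_def IA simp flip: rho_compose)
  qed
  have Jc: "B \<odot> J = J \<odot> B" if "B \<in> N" for B using JA[OF that] by simp
  \<comment> \<open>J \<iota> is a central self-adjoint square root of 1, and Q is its spectral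
    projection for the eigenvalue -1, where \<iota> coincides with J.\<close>
  define Q where "Q = (1/2) *\<^sub>R (id_blinfun - J \<odot> \<iota>)"
  have J\<iota>: "\<iota> \<odot> J = J \<odot> \<iota>" by (rule Jc[OF \<iota>])
  note rules = JJ \<iota>\<iota> J\<iota>
  have Q: "central_projection N Q"
    unfolding central_projection_def
  proof (intro conjI ballI)
    show "Q \<in> N" using J \<iota> by (simp add: Q_def)
    have "(id_blinfun - J \<odot> \<iota>) \<odot> (id_blinfun - J \<odot> \<iota>) = 2 *\<^sub>R (id_blinfun - J \<odot> \<iota>)"
      by (simp add: op_ring rules rules[THEN op_compose_left] scaleR_2)
    then show "Q \<odot> Q = Q" by (simp add: Q_def op_ring(7,8))
    show "adj Q = Q"
      using J \<iota> by (simp add: Q_def adjJ adj\<iota> op_ring J\<iota>)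
    show "B \<odot> Q = Q \<odot> B" if "B \<in> N" for B
      using that by (simp add: Q_def op_ring Jc \<iota>c op_compose_left[OF Jc] op_compose_left[OF \<iota>c])
  qed
  have QN: "Q \<in> N" "Q \<odot> Q = Q" "adj Q = Q" "\<And>B. B \<in> N \<Longrightarrow> B \<odot> Q = Q \<odot> B"
    using Q by (simp_all add: central_projection_def)
  have \<iota>Q: "\<iota> \<odot> Q = J \<odot> Q"
    by (simp add: Q_def op_ring rules rules[THEN op_compose_left])
  have \<iota>Q': "\<iota> \<odot> (id_blinfun - Q) = - (J \<odot> (id_blinfun - Q))"
  proof -
    have "(1/2) *\<^sub>R D + (1/2) *\<^sub>R D = D" for D :: "'k \<Rightarrow>\<^sub>L 'k" by (simp flip: scaleR_add_left)
    then have Q': "id_blinfun - Q = (1/2) *\<^sub>R (id_blinfun + J \<odot> \<iota>)"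
      by (simp add: Q_def algebra_simps)
    show ?thesis
      unfolding Q' by (simp add: op_ring rules rules[THEN op_compose_left] flip: scaleR_minus_right)
  qed
  obtain P where P: "P \<in> M" "\<rho> P = Q" using rho_surj[OF QN(1)] by blast
  have Pc: "central_projection M P"
    unfolding central_projection_def
  proof (intro conjI ballI)
    show "P \<odot> P = P" "adj P = P"
      using rho_eq_iff[of "P \<odot> P" P] rho_eq_iff[of "adj P" P] P QN(1-3)
      by (simp_all add: rho_compose rho_adj)
    show "A \<odot> P = P \<odot> A" if "A \<in> M" for A
      using rho_eq_iff[of "A \<odot> P" "P \<odot> A"] P QN(4)[of "\<rho> A"] that by (simp add: rho_compose)
  qed (rule P)
  have PM: "P \<odot> P = P" using Pc by (simp add: central_projection_def)
  have P': "id_blinfun - P \<in> M" "\<rho> (id_blinfun - P) = id_blinfun - Q"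
    using P by (simp_all add: rho_diff rho_id)
  \<comment> \<open>Real-linearity leaves only multiplication by i to be determined, and \<rho>
    turns it into multiplication by \<iota>.\<close>
  have decomp: "op_scaleC c A = Re c *\<^sub>R A + Im c *\<^sub>R op_scaleC \<i> A" for c and A :: "'z::chilbert_space \<Rightarrow>\<^sub>L 'z"
    by (subst complex_eq[of c]) (simp only: op_scaleC_add_left op_scaleC_of_real mult.commute[of \<i>] flip: op_scaleC_op_scaleC)
  have sc: "\<rho> (op_scaleC c A) = Re c *\<^sub>R \<rho> A + Im c *\<^sub>R (\<iota> \<odot> \<rho> A)" if "A \<in> M" for c A
    using that I by (subst decomp) (simp add: rho_add rho_scaleR \<iota>_def flip: IA rho_compose)
  have memP: "A \<in> M \<and> A \<odot> P = A" if "A \<in> summand M P" for A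
    using that P(1) by (auto simp: summand_def op_compose_assoc PM)
  have memP': "A \<in> M \<and> A \<odot> (id_blinfun - P) = A" if "A \<in> summand M (id_blinfun - P)" for A
    using that P(1) by (auto simp: summand_def op_ring PM)
  have \<iota>T: "\<iota> \<odot> B = B \<odot> (\<iota> \<odot> T)" and JT: "B \<odot> (J \<odot> T) = op_scaleC \<i> B"
    if B: "B \<in> N" "B \<odot> T = B" for B T
  proof -
    have "B \<odot> (\<iota> \<odot> T) = \<iota> \<odot> (B \<odot> T)" by (simp add: \<iota>c[OF B(1)] flip: op_compose_assoc)
    then show "\<iota> \<odot> B = B \<odot> (\<iota> \<odot> T)" by (simp only: B(2))
    have "B \<odot> (J \<odot> T) = op_scaleC \<i> (B \<odot> T)"
      by (simp add: JA(2)[OF B(1)] op_scaleC_compose_left flip: op_compose_assoc)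
    then show "B \<odot> (J \<odot> T) = op_scaleC \<i> B" by (simp only: B(2))
  qed
  have "star_isomorphism (summand M P) (summand N Q) \<rho>"
    unfolding star_isomorphism_def
  proof (intro conjI ballI allI)
    show "bij_betw \<rho> (summand M P) (summand N Q)" using rho_summand_bij[OF P(1)] P(2) by simp
    fix c A assume A: "A \<in> summand M P"
    have AQ: "\<rho> A \<in> N" "\<rho> A \<odot> Q = \<rho> A" using memP[OF A] P by (auto simp flip: rho_compose)
    have "\<iota> \<odot> \<rho> A = \<rho> A \<odot> (\<iota> \<odot> Q)" by (rule \<iota>T[OF AQ])
    also have "\<dots> = op_scaleC \<i> (\<rho> A)" unfolding \<iota>Q by (rule JT[OF AQ])
    finally show "\<rho> (op_scaleC c A) = op_scaleC c (\<rho> A)"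
      using memP[OF A] by (simp add: sc decomp[of c "\<rho> A"])
  qed (use memP in \<open>auto simp: rho_add rho_compose rho_adj\<close>)
  moreover have "conj_star_isomorphism (summand M (id_blinfun - P)) (summand N (id_blinfun - Q)) \<rho>"
    unfolding conj_star_isomorphism_def
  proof (intro conjI ballI allI)
    show "bij_betw \<rho> (summand M (id_blinfun - P)) (summand N (id_blinfun - Q))"
      using rho_summand_bij[OF P'(1)] P'(2) by simp
    fix c A assume A: "A \<in> summand M (id_blinfun - P)"
    have AQ: "\<rho> A \<in> N" "\<rho> A \<odot> (id_blinfun - Q) = \<rho> A"
      using memP'[OF A] P' rho_compose[of A "id_blinfun - P"] by auto
    have "\<iota> \<odot> \<rho> A = \<rho> A \<odot> (\<iota> \<odot> (id_blinfun - Q))" by (rule \<iota>T[OF AQ])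
    also have "\<dots> = - op_scaleC \<i> (\<rho> A)"
      unfolding \<iota>Q' bounded_bilinear.minus_right[OF bounded_bilinear_blinfun_compose] JT[OF AQ] ..
    finally show "\<rho> (op_scaleC c A) = op_scaleC (cnj c) (\<rho> A)"
      using memP'[OF A] by (simp add: sc decomp[of "cnj c" "\<rho> A"])
  qed (use memP' in \<open>auto simp: rho_add rho_compose rho_adj\<close>)
  moreover have "\<rho> A = \<rho> (A \<odot> P) + \<rho> (A \<odot> (id_blinfun - P))" if "A \<in> M" for A
    using that P P' by (simp add: op_ring flip: rho_add)
  ultimately show ?thesis
    unfolding direct_sum_star_conj_star_def using Pc Q by blast
qed

end

no_notation blinfun_compose (infixl "\<odot>" 70)

theorem theorem1p2:
  fixes M :: "('h::chilbert_space \<Rightarrow>\<^sub>L 'h) set"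
    and N :: "('k::chilbert_space \<Rightarrow>\<^sub>L 'k) set"
    and \<phi> :: "('h \<Rightarrow>\<^sub>L 'h) \<Rightarrow> ('k \<Rightarrow>\<^sub>L 'k)"
  assumes "von_neumann_algebra M"
    and "von_neumann_algebra N"
    and "no_type_I1_summand M"
    and "ortho_additive M \<phi>"
    and "ortho_isomorphism M N \<phi>"
  shows "\<exists>\<Phi>. \<Phi> \<in> M \<rightarrow> N \<and>
    (\<forall>A\<in>M. \<phi> A = \<Phi> A o\<^sub>L \<phi> id_blinfun) \<and>
    direct_sum_star_conj_star M N \<Phi>"
proof -
  interpret ortho_additive_iso M N \<phi>
    using assms by unfold_locales
  show ?thesis
    using rho_mem phi_eq_rho rho_direct_sum by (intro exI[of _ \<rho>] conjI ballI funcsetI)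
qed

end
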